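(* Let $n,r,k$ and $t$ be positive integers with $n\ge t+2$, $n\ge r\ge t+1$ and $k\ge\max\{2,g(n,r,t)\}$. Suppose that $\mathcal{F}$ is a maximal non-trivial $t$-intersecting subfamily of $\mathcal{L}_{n,r,k}$. Then $|\mathcal{F}|\ge f(n,r,k,r,t)$ if and only if one of the following holds. (i) $r\ge t+2$ and $\mathcal{F}\cong\mathcal{H}_1(n,r,k,m,t)$ for some $m\in\{r,\min\{r+1,n\}\}$. (ii) $n\ge r+2\ge t+4$ and $\mathcal{F}\cong\mathcal{H}_2(n,r,k,c,t)$ for some $c\in\{r+2,\dots,\min\{2r-t,n\}\}$. (iii) $r\le 2t+2$, $r\neq t+2$ and $\mathcal{F}\cong\mathcal{H}_1(n,r,k,t+2,t)$.
   Context: Write $[n]=\{1,\dots,n\}$. For $k\ge 2$ and $1\le r\le n$, a $k$-signed $r$-set on $[n]$ is a set $\{(x_1,y_1),\dots,(x_r,y_r)\}$ with $x_1,\dots,x_r$ distinct elements of $[n]$ and $y_1,\dots,y_r\in[k]$; $\mathcal{L}_{n,r,k}$ denotes the set of all of these. A family $\mathcal{F}\subset\mathcal{L}_{n,r,k}$ is $t$-intersecting if $|F\cap F'|\ge t$ for all $F,F'\in\mathcal{F}$. It is trivial if there is a fixed $k$-signed $t$-set contained in every member of $\mathcal{F}$, and non-trivial otherwise. It is maximal if it is not properly contained in another $t$-intersecting subfamily of $\mathcal{L}_{n,r,k}$. For $\mathcal{F},\mathcal{G}\subset\mathcal{L}_{n,r,k}$, $\mathcal{F}\cong\mathcal{G}$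 means that there is a bijection $\sigma:[n]\times[k]\to[n]\times[k]$ with $\mathcal{G}=\{\sigma(F):F\in\mathcal{F}\}$. For $d\in[n]$ let $M_d=\{(1,1),(2,1),\dots,(d,1)\}$. For positive integers with $k\ge 2$, $t+1\le r\le n$ and $t+2\le\ell\le\min\{r+1,n\}$, $\mathcal{H}_1(n,r,k,\ell,t)$ is the set of all $F\in\mathcal{L}_{n,r,k}$ such that either $M_t\subset F$ and $|F\cap M_\ell|\ge t+1$, or $M_t\not\subset F$ and $|F\cap M_\ell|=\ell-1$. For positive integers with $k\ge2$, $t+2\le r\le n$ and $r+2\le c\le\min\{2r-t,n\}$, $\mathcal{H}_2(n,r,k,c,t)$ is the set of all $F\in\mathcal{L}_{n,r,k}$ such that one of the following holds: $M_t\subset F$ and $|F\cap M_r|\ge t+1$; or $F\cap M_r=M_t$ and $M_c\setminus M_r\subset F$; or $M_t\not\subset F$, $|F\cap M_r|=r-1$ and $|F\cap(M_c\setminus M_r)|=1$. For $d\in[n]$, $$f(n,r,k,d,t)=(d-t)\binom{n-t-1}{r-t-1}k^{r-t-1}-\binom{d-t}{2}\binom{n-t-2}{r-t-2}k^{r-t-2},$$ $$g(n,r,t)=\frac{(r-t+3)(r-t-1)}{n-t-1}\cdot\max\left\{\binom{t+2}{2},\frac{r-t+1}{2}\right\}.$$ Binomial coefficients $\binom{a}{b}$ with $b<0$ are $0$. *)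

theory Defs
  imports Complex_Main
begin

definition is_signed_set :: "nat \<Rightarrow> nat \<Rightarrow> nat \<Rightarrow> (nat \<times> nat) set \<Rightarrow> bool" where
  "is_signed_set n r k F \<longleftrightarrow>
     (\<exists>x y. inj_on x {1..r} \<and> x ` {1..r} \<subseteq> {1..n} \<and> y ` {1..r} \<subseteq> {1..k} \<and>
            F = (\<lambda>i. (x i, y i)) ` {1..r})"

definition signed_sets :: "nat \<Rightarrow> nat \<Rightarrow> nat \<Rightarrow> (nat \<times> nat) set set" where
  "signed_sets n r k = {F. is_signed_set n r k F}"

lemma is_signed_set_iff:
  "is_signed_set n r k F \<longleftrightarrow> F \<subseteq> {1..n} \<times> {1..k} \<and> inj_on fst F \<and> card F = r"
proof
  assume "is_signed_set n r k F"
  then obtain x y where x: "inj_on x {1..r}" "x ` {1..r} \<subseteq> {1..n}"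
    and y: "y ` {1..r} \<subseteq> {1..k}" and F: "F = (\<lambda>i. (x i, y i)) ` {1..r}"
    unfolding is_signed_set_def by (elim exE conjE)
  have "inj_on (\<lambda>i. (x i, y i)) {1..r}"
    by (rule inj_onI) (use x(1) in \<open>auto dest: inj_onD\<close>)
  then have "card F = r" unfolding F by (simp add: card_image)
  moreover have "inj_on fst F"
    unfolding F by (rule inj_on_imageI) (use x(1) in \<open>simp add: comp_def\<close>)
  moreover have "F \<subseteq> {1..n} \<times> {1..k}"
    unfolding F by (rule image_subsetI, rule SigmaI) (use x(2) y in blast)+
  ultimately show "F \<subseteq> {1..n} \<times> {1..k} \<and> inj_on fst F \<and> card F = r" by blast
next
  assume A: "F \<subseteq> {1..n} \<times> {1..k} \<and> inj_on fst F \<and> card F = r"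
  then have "finite F" by (meson finite_SigmaI finite_atLeastAtMost finite_subset)
  then obtain h where h: "bij_betw h {1..r} F"
    using A ex_bij_betw_nat_finite_1 by blast
  have im: "h ` {1..r} = F" and inj: "inj_on h {1..r}" using h by (simp_all add: bij_betw_def)
  have "inj_on (fst \<circ> h) {1..r}"
    by (rule comp_inj_on) (use inj im A in simp_all)
  moreover have "(fst \<circ> h) ` {1..r} = fst ` F" "(snd \<circ> h) ` {1..r} = snd ` F"
    by (simp_all only: image_comp[symmetric] im)
  moreover have "fst ` F \<subseteq> {1..n}" "snd ` F \<subseteq> {1..k}"
    using A by auto
  moreover have "F = (\<lambda>i. ((fst \<circ> h) i, (snd \<circ> h) i)) ` {1..r}"
    unfolding comp_def prod.collapse by (rule im[symmetric])
  ultimately show "is_signed_set n r k F"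
    unfolding is_signed_set_def by (intro exI[of _ "fst \<circ> h"] exI[of _ "snd \<circ> h"] conjI) simp_all
qed

lemma finite_signed_sets: "finite (signed_sets n r k)"
proof (rule finite_subset)
  show "signed_sets n r k \<subseteq> Pow ({1..n} \<times> {1..k})"
    by (auto simp: signed_sets_def is_signed_set_iff)
qed simp

definition t_intersecting :: "nat \<Rightarrow> (nat \<times> nat) set set \<Rightarrow> bool" where
  "t_intersecting t \<F> \<longleftrightarrow> (\<forall>F\<in>\<F>. \<forall>F'\<in>\<F>. card (F \<inter> F') \<ge> t)"

definition trivial_family :: "nat \<Rightarrow> nat \<Rightarrow> nat \<Rightarrow> (nat \<times> nat) set set \<Rightarrow> bool" where
  "trivial_family n k t \<F> \<longleftrightarrow> (\<exists>T. is_signed_set n t k T \<and> (\<forall>F\<in>\<F>. T \<subseteq> F))"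

text \<open>Maximality is taken among all \<open>t\<close>-intersecting subfamilies, not merely
  among the non-trivial ones.\<close>

definition maximal_t_intersecting ::
    "nat \<Rightarrow> nat \<Rightarrow> nat \<Rightarrow> nat \<Rightarrow> (nat \<times> nat) set set \<Rightarrow> bool" where
  "maximal_t_intersecting n r k t \<F> \<longleftrightarrow>
     \<F> \<subseteq> signed_sets n r k \<and> t_intersecting t \<F> \<and>
     (\<forall>\<G>. \<G> \<subseteq> signed_sets n r k \<and> t_intersecting t \<G> \<longrightarrow> \<not> \<F> \<subset> \<G>)"

text \<open>The bijection \<open>\<sigma>\<close> is arbitrary: it need not map signed sets to signed sets.\<close>

definition family_iso ::
    "nat \<Rightarrow> nat \<Rightarrow> (nat \<times> nat) set set \<Rightarrow> (nat \<times> nat) set set \<Rightarrow> bool" where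
  "family_iso n k \<F> \<G> \<longleftrightarrow>
     (\<exists>\<sigma>. bij_betw \<sigma> ({1..n} \<times> {1..k}) ({1..n} \<times> {1..k}) \<and> \<G> = (\<lambda>F. \<sigma> ` F) ` \<F>)"

definition M :: "nat \<Rightarrow> (nat \<times> nat) set" where
  "M d = {1..d} \<times> {1}"

text \<open>Intended for \<open>k \<ge> 2\<close>, \<open>t + 1 \<le> r \<le> n\<close> and \<open>t + 2 \<le> l \<le> min (r + 1) n\<close>.\<close>

definition H1 :: "nat \<Rightarrow> nat \<Rightarrow> nat \<Rightarrow> nat \<Rightarrow> nat \<Rightarrow> (nat \<times> nat) set set" where
  "H1 n r k l t = {F \<in> signed_sets n r k.
     (M t \<subseteq> F \<and> card (F \<inter> M l) \<ge> t + 1) \<or>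
     (\<not> M t \<subseteq> F \<and> card (F \<inter> M l) = l - 1)}"

text \<open>Intended for \<open>k \<ge> 2\<close>, \<open>t + 2 \<le> r \<le> n\<close> and \<open>r + 2 \<le> c \<le> min (2 * r - t) n\<close>.\<close>

definition H2 :: "nat \<Rightarrow> nat \<Rightarrow> nat \<Rightarrow> nat \<Rightarrow> nat \<Rightarrow> (nat \<times> nat) set set" where
  "H2 n r k c t = {F \<in> signed_sets n r k.
     (M t \<subseteq> F \<and> card (F \<inter> M r) \<ge> t + 1) \<or>
     (F \<inter> M r = M t \<and> M c - M r \<subseteq> F) \<or>
     (\<not> M t \<subseteq> F \<and> card (F \<inter> M r) = r - 1 \<and> card (F \<inter> (M c - M r)) = 1)}"

text \<open>Integer arguments, so that a negative lower index such as \<open>r - t - 2\<close>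
  for \<open>r = t + 1\<close> gives \<open>0\<close> instead of being truncated.\<close>

definition binom :: "int \<Rightarrow> int \<Rightarrow> real" where
  "binom a b = (if b < 0 then 0 else of_int a gchoose nat b)"

definition f :: "nat \<Rightarrow> nat \<Rightarrow> nat \<Rightarrow> nat \<Rightarrow> nat \<Rightarrow> real" where
  "f n r k d t =
     (real d - real t) * binom (int n - int t - 1) (int r - int t - 1)
       * real k powi (int r - int t - 1)
     - binom (int d - int t) 2 * binom (int n - int t - 2) (int r - int t - 2)
       * real k powi (int r - int t - 2)"

definition g :: "nat \<Rightarrow> nat \<Rightarrow> nat \<Rightarrow> real" where
  "g n r t =
     (real r - real t + 3) * (real r - real t - 1) / (real n - real t - 1)
       * max (binom (int t + 2) 2) ((real r - real t + 1) / 2)"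

end

theory Submission
  imports Defs "HOL-Combinatorics.Transposition"
begin

text \<open>
  Call a signed set a cover of the family if it meets every member in at least \<open>t\<close> points,
  and put \<open>s = r - t\<close>. By maximality every \<open>r\<close>-set containing a cover is a member, so the
  covers of size \<open>t + 1\<close> themselves form a \<open>t\<close>-intersecting family. If there are none, members are
  caught by extending a \<open>t\<close>-subset of a minimum cover point by point inside members that it
  meets too little, which gives at most \<open>((t + 2) choose 2) * (s + 1)^2\<close> stars
  over \<open>(t + 2)\<close>-sets, too few. If the covers have no common \<open>t\<close>-subset, three of them span
  a \<open>(t + 2)\<close>-set that all members meet in at least \<open>t + 1\<close> points. Otherwise the covers are
  the sets \<open>insert x E\<close> with \<open>x \<in> D\<close>; a member not containing \<open>E\<close> contains
  \<open>D\<close> and all but one point of \<open>E\<close>, so \<open>card D \<le> s + 1\<close>. The values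
  \<open>s + 1\<close> and \<open>s\<close> force the extremal families, and for smaller \<open>D\<close>
  the family has about \<open>card D\<close> stars over \<open>(t + 1)\<close>-sets while
  \<open>f n r k r t\<close> amounts to more than \<open>s - 1\<close> of them.
\<close>

section \<open>Counting signed sets\<close>

text \<open>The hypothesis on \<open>k\<close> is spent on one quantity, the ratio \<open>B\<close>
  of the sizes of stars over \<open>(t + 2)\<close>-sets and \<open>(t + 1)\<close>-sets. After
  division by the latter every upper bound is a constant plus a multiple of \<open>B\<close>, to be
  compared with \<open>s - s * (s - 1) / 2 * B\<close>. The binomial in \<open>g\<close> mainly pays
  for choosing a \<open>t\<close>-subset or a point inside a cover, the term
  \<open>(r - t + 1) / 2\<close> for the pair correction in \<open>f\<close>. The factor
  \<open>r - t + 3\<close> is visible in the case without small covers, where everything comes down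
  to \<open>(s + 1)^3 + s * (s - 1) < s * (s + 3) * (s + 1)\<close>, that is, \<open>s > 1\<close>.
  The obstacle is economy: forcing a member to take a further point of another member costs a factor
  \<open>s + 1\<close>, and there is little room. Hence the members not containing \<open>E\<close>
  are counted separately for \<open>card D\<close> equal to 1, equal to 2 and at least 3, with two,
  one and no such branchings; in the first case one of the two factors has to be trimmed from
  \<open>s + 1\<close> to \<open>s\<close>.\<close>

definition signed_over :: "'a set \<Rightarrow> 'b set \<Rightarrow> nat \<Rightarrow> ('a \<times> 'b) set set" where
  "signed_over A K q = {F. F \<subseteq> A \<times> K \<and> inj_on fst F \<and> card F = q}"

lemma signed_sets_eq_signed_over: "signed_sets n q k = signed_over {1..n} {1..k} q"
  by (simp add: signed_sets_def signed_over_def is_signed_set_iff)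

lemma finite_signed_over: "finite A \<Longrightarrow> finite K \<Longrightarrow> finite (signed_over A K q)"
  by (rule finite_subset[of _ "Pow (A \<times> K)"]) (auto simp: signed_over_def)

lemma finite_mem_signed_over:
  "F \<in> signed_over A K q \<Longrightarrow> finite A \<Longrightarrow> finite K \<Longrightarrow> finite F"
  by (auto simp: signed_over_def intro: finite_subset[of F "A \<times> K"])

lemma signed_over_0: "finite A \<Longrightarrow> finite K \<Longrightarrow> signed_over A K 0 = {{}}"
  by (auto simp: signed_over_def dest: finite_subset[OF _ finite_cartesian_product])

lemma signed_over_insert:
  assumes "finite A" "finite K" "a \<notin> A"
  shows "signed_over (insert a A) K (Suc q) =
    signed_over A K (Suc q) \<union> (\<lambda>(y, F). insert (a, y) F) ` (K \<times> signed_over A K q)"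
    (is "?L = ?R")
proof
  show "?L \<subseteq> ?R"
  proof
    fix F assume F: "F \<in> ?L"
    then have fin: "finite F"
      using assms by (intro finite_mem_signed_over[of F "insert a A" K "Suc q"]) auto
    show "F \<in> ?R"
    proof (cases "\<exists>y. (a, y) \<in> F")
      case False
      then have "F \<subseteq> A \<times> K" using F by (auto simp: signed_over_def)
      then show ?thesis using F by (simp add: signed_over_def)
    next
      case True
      then obtain y where y: "(a, y) \<in> F" by blast
      have inj: "inj_on fst F" using F by (simp add: signed_over_def)
      have "z \<in> A \<times> K" if "z \<in> F - {(a, y)}" for z
      proof -
        have "fst z \<noteq> a" using that y inj_onD[OF inj, of z "(a, y)"] by auto
        then show ?thesis using that F by (auto simp: signed_over_def)
      qed
      then have "F - {(a, y)} \<in> signed_over A K q"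
        using F y fin by (auto simp: signed_over_def intro: inj_on_subset)
      moreover have "y \<in> K" using F y by (auto simp: signed_over_def)
      moreover have "F = insert (a, y) (F - {(a, y)})" using y by blast
      ultimately show ?thesis by blast
    qed
  qed
  have "insert (a, y) F \<in> ?L" if "y \<in> K" "F \<in> signed_over A K q" for y F
  proof -
    have "finite F" using that assms by (intro finite_mem_signed_over)
    moreover have "a \<notin> fst ` F" using that assms by (auto simp: signed_over_def)
    ultimately show ?thesis using that by (auto simp: signed_over_def card_insert_if rev_image_eqI intro: inj_on_subset)
  qed
  then have "(\<lambda>(y, F). insert (a, y) F) ` (K \<times> signed_over A K q) \<subseteq> ?L" by (simp add: image_subset_iff)
  moreover have "signed_over A K (Suc q) \<subseteq> ?L" by (auto simp: signed_over_def)
  ultimately show "?R \<subseteq> ?L" by (rule Un_least[rotated])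
qed

lemma signed_over_empty: "signed_over {} K q = (if q = 0 then {{}} else {})"
  by (auto simp: signed_over_def)

lemma card_signed_over:
  assumes "finite A" "finite K"
  shows "card (signed_over A K q) = (card A choose q) * card K ^ q"
  using assms(1)
proof (induction A arbitrary: q rule: finite_induct)
  case empty
  show ?case by (simp add: signed_over_empty binomial_eq_0)
next
  case (insert a A)
  show ?case
  proof (cases q)
    case 0
    then show ?thesis using insert.hyps assms by (simp add: signed_over_0)
  next
    case (Suc p)
    let ?h = "\<lambda>(y, F). insert (a, y) F"
    have notin: "(a, y) \<notin> F" if "F \<in> signed_over A K p'" for y F p'
      using that insert.hyps by (auto simp: signed_over_def)
    have inj: "inj_on ?h (K \<times> signed_over A K p)"
    proof (rule inj_onI, clarify)
      fix y F z G
      assume *: "F \<in> signed_over A K p" "G \<in> signed_over A K p"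
        "insert (a, y) F = insert (a, z) G"
      have "(a, y) \<notin> F" "(a, y) \<notin> G" "(a, z) \<notin> F" "(a, z) \<notin> G" using * notin by blast+
      moreover from this have "(a, y) = (a, z)" using *(3) by (metis insert_iff)
      ultimately show "y = z \<and> F = G" using *(3) by (simp add: insert_ident)
    qed
    have "signed_over A K (Suc p) \<inter> ?h ` (K \<times> signed_over A K p) = {}"
      using notin by fastforce
    then have "card (signed_over (insert a A) K (Suc p)) =
        card (signed_over A K (Suc p)) + card (?h ` (K \<times> signed_over A K p))"
      unfolding signed_over_insert[OF insert.hyps(1) assms(2) insert.hyps(2)]
      using insert.hyps assms by (intro card_Un_disjoint) (auto intro: finite_signed_over)
    also have "\<dots> = card (signed_over A K (Suc p)) + card K * card (signed_over A K p)"
      by (simp add: card_image[OF inj] card_cartesian_product)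
    also have "\<dots> = (card (insert a A) choose q) * card K ^ q"
      using insert by (simp add: Suc algebra_simps)
    finally show ?thesis using Suc by simp
  qed
qed

text \<open>The value 0 for \<open>q > r\<close> matters: truncated subtraction would give 1 and
  spoil the bound on consecutive ratios at \<open>q = r\<close>.\<close>

definition star_size :: "nat \<Rightarrow> nat \<Rightarrow> nat \<Rightarrow> nat \<Rightarrow> nat" where
  "star_size n r k q = (if q \<le> r then ((n - q) choose (r - q)) * k ^ (r - q) else 0)"

lemma signed_setsD:
  assumes "F \<in> signed_sets n q k"
  shows "F \<subseteq> {1..n} \<times> {1..k}" "inj_on fst F" "card F = q" "finite F"
  using assms finite_mem_signed_over[of F "{1..n}" "{1..k}" q]
  by (auto simp: signed_sets_eq_signed_over signed_over_def)

lemma signed_setsI: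
  "F \<subseteq> {1..n} \<times> {1..k} \<Longrightarrow> inj_on fst F \<Longrightarrow> card F = q \<Longrightarrow> F \<in> signed_sets n q k"
  by (simp add: signed_sets_eq_signed_over signed_over_def)

lemma signed_sets_subset:
  "F \<in> signed_sets n q k \<Longrightarrow> S \<subseteq> F \<Longrightarrow> S \<in> signed_sets n (card S) k"
  by (auto simp: signed_sets_eq_signed_over signed_over_def intro: inj_on_subset)

lemma card_star:
  assumes S: "S \<in> signed_sets n q k"
  shows "card {F \<in> signed_sets n r k. S \<subseteq> F} = star_size n r k q"
proof (cases "q \<le> r")
  case False
  have "{F \<in> signed_sets n r k. S \<subseteq> F} = {}"
    using False signed_setsD(3)[OF S] by (metis (no_types, lifting) Collect_empty_eq card_mono signed_setsD(3,4))
  then have "card {F \<in> signed_sets n r k. S \<subseteq> F} = 0" by (simp only: card.empty)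
  then show ?thesis using False by (simp only: star_size_def if_False)
next
  case True
  note S' = signed_setsD[OF S]
  let ?A = "{1..n} - fst ` S"
  have "bij_betw (\<lambda>F. F - S) {F \<in> signed_sets n r k. S \<subseteq> F} (signed_over ?A {1..k} (r - q))"
  proof (rule bij_betw_byWitness[where f' = "\<lambda>G. G \<union> S"])
    show "\<forall>F\<in>{F \<in> signed_sets n r k. S \<subseteq> F}. F - S \<union> S = F" by blast
    have disj: "G \<inter> S = {}" if "G \<in> signed_over ?A {1..k} (r - q)" for G
      using that by (force simp: signed_over_def)
    then show "\<forall>G\<in>signed_over ?A {1..k} (r - q). G \<union> S - S = G" by (simp add: Un_Diff Diff_triv)
    show "(\<lambda>F. F - S) ` {F \<in> signed_sets n r k. S \<subseteq> F} \<subseteq> signed_over ?A {1..k} (r - q)"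
    proof clarify
      fix F assume F: "F \<in> signed_sets n r k" "S \<subseteq> F"
      note F' = signed_setsD[OF F(1)]
      have "F - S \<subseteq> ?A \<times> {1..k}"
      proof
        fix z assume z: "z \<in> F - S"
        have "fst z \<notin> fst ` S"
        proof
          assume "fst z \<in> fst ` S"
          then obtain w where "w \<in> S" "fst z = fst w" by blast
          then show False using inj_onD[OF F'(2), of z w] z F(2) by blast
        qed
        moreover have "z \<in> {1..n} \<times> {1..k}" using z F'(1) by blast
        ultimately show "z \<in> ?A \<times> {1..k}" by (cases z) auto
      qed
      moreover have "card (F - S) = r - q"
        using F F' S' by (simp add: card_Diff_subset)
      moreover have "inj_on fst (F - S)" using F'(2) by (rule inj_on_subset) blast
      ultimately show "F - S \<in> signed_over ?A {1..k} (r - q)" by (simp add: signed_over_def)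
    qed
    show "(\<lambda>G. G \<union> S) ` signed_over ?A {1..k} (r - q) \<subseteq> {F \<in> signed_sets n r k. S \<subseteq> F}"
    proof clarify
      fix G assume G: "G \<in> signed_over ?A {1..k} (r - q)"
      then have "finite G" by (rule finite_mem_signed_over) auto
      then have "card (G \<union> S) = r"
        using G S' True disj[OF G] by (simp add: card_Un_disjoint signed_over_def)
      moreover have "inj_on fst (G \<union> S)"
        using G S'(2) by (force simp: signed_over_def inj_on_Un)
      moreover have "G \<union> S \<subseteq> {1..n} \<times> {1..k}"
        using G S'(1) by (auto simp: signed_over_def)
      ultimately show "G \<union> S \<in> signed_sets n r k \<and> S \<subseteq> G \<union> S" by (simp add: signed_setsI)
    qed
  qed
  then have "card {F \<in> signed_sets n r k. S \<subseteq> F} = card (signed_over ?A {1..k} (r - q))"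
    by (rule bij_betw_same_card)
  moreover have "card ?A = n - q"
    using S' by (subst card_Diff_subset) (auto simp: card_image)
  ultimately show ?thesis using True by (simp add: card_signed_over star_size_def)
qed

text \<open>\<open>S\<close> may be any set: if no member contains it the count is 0, and otherwise
  it inherits being a signed set from a member.\<close>

lemma card_star_le:
  assumes "\<F> \<subseteq> signed_sets n r k"
  shows "card {F \<in> \<F>. S \<subseteq> F} \<le> star_size n r k (card S)"
proof (cases "\<exists>F\<in>\<F>. S \<subseteq> F")
  case False
  then have "{F \<in> \<F>. S \<subseteq> F} = {}" by blast
  then show ?thesis by (simp only: card.empty le0)
next
  case True
  then have "S \<in> signed_sets n (card S) k" using assms signed_sets_subset by blast
  then have "card {F \<in> signed_sets n r k. S \<subseteq> F} = star_size n r k (card S)" by (rule card_star)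
  moreover have "card {F \<in> \<F>. S \<subseteq> F} \<le> card {F \<in> signed_sets n r k. S \<subseteq> F}"
    using assms finite_signed_sets by (intro card_mono) auto
  ultimately show ?thesis by simp
qed

lemma star_size_pos: "k \<ge> 1 \<Longrightarrow> q \<le> r \<Longrightarrow> r \<le> n \<Longrightarrow> star_size n r k q > 0"
  by (simp add: star_size_def)

text \<open>For \<open>q < r\<close> the exact ratio is \<open>(r - q) / ((n - q) * k)\<close>.
  Since \<open>r \<le> n\<close>, it does not increase with \<open>q\<close>, so its value at
  \<open>q = t + 1\<close> bounds all later ones.\<close>

lemma star_size_Suc:
  assumes "t + 1 \<le> q" "t + 2 \<le> n" "r \<le> n" "k \<ge> 1" "t + 1 \<le> r"
  shows "real (star_size n r k (Suc q)) * ((real n - real t - 1) * real k)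
    \<le> (real r - real t - 1) * real (star_size n r k q)"
proof (cases "q < r")
  case False
  then show ?thesis using assms by (simp add: star_size_def)
next
  case True
  obtain a where a: "r = Suc (q + a)" using True by (metis less_iff_Suc_add)
  obtain b where b: "n = r + b" using assms by (metis le_iff_add)
  obtain c where c: "q = t + 1 + c" using assms by (metis le_iff_add)
  have "Suc a * (Suc (a + b) choose Suc a) = Suc (a + b) * (a + b choose a)"
    by (rule Suc_times_binomial)
  then have *: "(real a + 1) * real (Suc (a + b) choose Suc a) = (1 + real a + real b) * real (a + b choose a)"
    by (metis (no_types, lifting) add.commute add.left_commute of_nat_Suc of_nat_add of_nat_mult)
  have "real (a + b choose a) * (1 + real a + real b + real c)
      = (real a + 1) * real (Suc (a + b) choose Suc a) + real c * real (a + b choose a)"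
    unfolding * by (simp add: algebra_simps)
  also have "\<dots> \<le> (real a + 1) * real (Suc (a + b) choose Suc a) + real c * real (Suc (a + b) choose Suc a)"
    by (intro add_left_mono mult_left_mono) auto
  finally have "real (a + b choose a) * (1 + real a + real b + real c)
      \<le> (real a + real c + 1) * real (Suc (a + b) choose Suc a)" by (simp add: algebra_simps)
  from mult_right_mono[OF this, of "real k ^ Suc a"]
  have "real (a + b choose a) * real k ^ a * ((1 + real a + real b + real c) * real k)
      \<le> (real a + real c + 1) * (real (Suc (a + b) choose Suc a) * real k ^ Suc a)"
    by (simp add: mult_ac)
  moreover have "star_size n r k (Suc q) = (a + b choose a) * k ^ a"
    "star_size n r k q = (Suc (a + b) choose Suc a) * k ^ Suc a"
    by (simp_all add: star_size_def a b)
  moreover have "real n - real t - 1 = 1 + real a + real b + real c" "real r - real t - 1 = real a + real c + 1"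
    by (simp_all add: a b c)
  ultimately show ?thesis by (simp only: of_nat_mult of_nat_power)
qed

lemma card_le_card_times:
  fixes b :: nat
  assumes "finite I" "\<A> \<subseteq> (\<Union>i\<in>I. \<B> i)" "\<And>i. i \<in> I \<Longrightarrow> finite (\<B> i)" "\<And>i. i \<in> I \<Longrightarrow> card (\<B> i) \<le> b"
  shows "card \<A> \<le> card I * b"
proof -
  have "card \<A> \<le> card (\<Union>i\<in>I. \<B> i)" using assms by (intro card_mono) auto
  also have "\<dots> \<le> (\<Sum>i\<in>I. card (\<B> i))" using assms(1) by (rule card_UN_le)
  also have "\<dots> \<le> card I * b" using assms(4) sum_bounded_above[of I "\<lambda>i. card (\<B> i)" b] by simp
  finally show ?thesis .
qed

text \<open>The second Bonferroni inequality: two distinct \<open>(t + 1)\<close>-sets have at least \<open>t + 2\<close> points in their union.\<close>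

lemma card_UN_stars_ge:
  assumes "finite \<T>" "\<T> \<subseteq> signed_sets n (t + 1) k"
  shows "real (card (\<Union>T\<in>\<T>. {F \<in> signed_sets n r k. T \<subseteq> F}))
    \<ge> real (card \<T>) * real (star_size n r k (t + 1))
      - real (card \<T> choose 2) * real (star_size n r k (t + 2))"
  using assms
proof (induction \<T> rule: finite_induct)
  case empty
  then show ?case by simp
next
  case (insert T \<T>)
  let ?S = "\<lambda>T. {F \<in> signed_sets n r k. T \<subseteq> F}"
  let ?U = "\<Union>T\<in>\<T>. ?S T"
  have fin: "finite (?S T)" for T using finite_signed_sets by simp
  have T: "T \<in> signed_sets n (t + 1) k" using insert.prems by blast
  have le: "card (?S T \<inter> ?S T') \<le> star_size n r k (t + 2)" if "T' \<in> \<T>" for T'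
  proof (cases "?S T \<inter> ?S T' = {}")
    case True
    then show ?thesis by (simp only: card.empty)
  next
    case False
    then obtain F where F: "F \<in> signed_sets n r k" "T \<subseteq> F" "T' \<subseteq> F" by blast
    have T': "T' \<in> signed_sets n (t + 1) k" "T' \<noteq> T" using insert that by auto
    note D = signed_setsD(3,4)[OF T] signed_setsD(3,4)[OF T'(1)]
    have "\<not> T' \<subseteq> T" using D T'(2) card_subset_eq by metis
    then have "T \<subset> T \<union> T'" by blast
    then have "t + 1 < card (T \<union> T')" using D psubset_card_mono[of "T \<union> T'" T] by simp
    then obtain W where W: "W \<subseteq> T \<union> T'" "card W = t + 2"
      by (metis Suc_eq_plus1 Suc_leI add_2_eq_Suc' obtain_subset_with_card_n)
    have "card (?S T \<inter> ?S T') \<le> card (?S W)"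
      using W(1) by (intro card_mono fin) blast
    also have "\<dots> \<le> star_size n r k (t + 2)"
      using card_star_le[of "signed_sets n r k" n r k W] W(2) by simp
    finally show ?thesis .
  qed
  have "card (?S T \<inter> ?U) \<le> card \<T> * star_size n r k (t + 2)"
    by (rule card_le_card_times[where \<B> = "\<lambda>T'. ?S T \<inter> ?S T'"])
      (use insert.hyps fin le in auto)
  then have "real (card (?S T \<inter> ?U)) \<le> real (card \<T>) * real (star_size n r k (t + 2))"
    unfolding of_nat_mult[symmetric] of_nat_le_iff .
  moreover have "card (?S T \<union> ?U) + card (?S T \<inter> ?U) = star_size n r k (t + 1) + card ?U"
    using card_Un_Int[of "?S T" ?U] fin insert.hyps card_star[OF T, of r] by simp
  then have "real (card (?S T \<union> ?U)) + real (card (?S T \<inter> ?U)) = real (star_size n r k (t + 1)) + real (card ?U)"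
    unfolding of_nat_add[symmetric] of_nat_eq_iff .
  moreover have "real (card (insert T \<T>) choose 2) = real (card \<T> choose 2) + real (card \<T>)"
    using insert.hyps by (simp add: numeral_2_eq_2)
  moreover note insert.IH
  ultimately show ?case using insert.hyps insert.prems by (simp add: algebra_simps)
qed

section \<open>Relabelling signed sets\<close>

lemma bij_betw_extend:
  assumes "bij_betw p A B" "A \<subseteq> A'" "B \<subseteq> B'" "finite A'" "finite B'" "card A' = card B'"
  obtains p' where "bij_betw p' A' B'" "\<forall>x\<in>A. p' x = p x"
proof -
  have "finite A" "finite B" using assms finite_subset by blast+
  then have "card (A' - A) = card (B' - B)"
    using assms bij_betw_same_card[OF assms(1)] by (simp add: card_Diff_subset)
  then obtain h where h: "bij_betw h (A' - A) (B' - B)"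
    using assms by (meson finite_Diff finite_same_card_bij)
  have "bij_betw (\<lambda>x. if x \<in> A then p x else h x) (A \<union> (A' - A)) (B \<union> (B' - B))"
    by (rule bij_betw_disjoint_Un[OF assms(1) h]) auto
  moreover have "A \<union> (A' - A) = A'" "B \<union> (B' - B) = B'" using assms by auto
  ultimately show ?thesis using that[of "\<lambda>x. if x \<in> A then p x else h x"] by simp
qed

lemma inj_on_image_subset_iff':
  "inj_on h U \<Longrightarrow> A \<subseteq> U \<Longrightarrow> B \<subseteq> U \<Longrightarrow> h ` A \<subseteq> h ` B \<longleftrightarrow> A \<subseteq> B"
  unfolding image_subset_iff using inj_on_image_mem_iff[of h U _ B] by (simp add: subset_iff Ball_def)

text \<open>A signed set has one value per coordinate, so it can be moved to an \<open>M d\<close>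
  by permuting coordinates and, within each coordinate, swapping the used value with 1. Such a map
  keeps points of one coordinate together and therefore preserves signed sets.\<close>

lemma signed_set_relabelling:
  assumes Z: "Z \<in> signed_sets n c k" and "E \<subseteq> X" "X \<subseteq> Z" and k: "k \<ge> 1"
  obtains \<sigma> where "bij_betw \<sigma> ({1..n} \<times> {1..k}) ({1..n} \<times> {1..k})"
    "\<forall>q. (\<lambda>F. \<sigma> ` F) ` signed_sets n q k = signed_sets n q k"
    "\<sigma> ` E = M (card E)" "\<sigma> ` X = M (card X)" "\<sigma> ` Z = M (card Z)"
proof -
  note Z' = signed_setsD[OF Z]
  let ?U = "{1..n} \<times> {1..k}"
  have fin: "finite Z" "finite X" "finite E" using Z'(4) assms by (auto intro: finite_subset)
  have cfst: "card (fst ` S) = card S" if "S \<subseteq> Z" for S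
    using that Z'(2) by (intro card_image) (rule inj_on_subset)
  have le: "card E \<le> card X" "card X \<le> card Z" using fin assms by (simp_all add: card_mono)
  have fZ: "fst ` Z \<subseteq> {1..n}" using Z'(1) by auto
  have cn: "card Z \<le> n" using card_mono[OF _ fZ] cfst[of Z] by simp
  \<comment> \<open>The coordinate permutation is built by successive extension from
    \<open>E\<close> to \<open>X\<close> to \<open>Z\<close>, so that all three land on initial
    segments at once.\<close>
  obtain p1 where p1: "bij_betw p1 (fst ` E) {1..card E}"
    using finite_same_card_bij[of "fst ` E" "{1..card E}"] fin cfst[of E] assms by auto
  obtain p2 where p2: "bij_betw p2 (fst ` X) {1..card X}" "\<forall>x\<in>fst ` E. p2 x = p1 x"
    using bij_betw_extend[OF p1, of "fst ` X" "{1..card X}"] fin cfst[of X] assms le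
    by (auto simp: image_mono)
  obtain p3 where p3: "bij_betw p3 (fst ` Z) {1..card Z}" "\<forall>x\<in>fst ` X. p3 x = p2 x"
    using bij_betw_extend[OF p2(1), of "fst ` Z" "{1..card Z}"] fin cfst[of Z] assms le
    by (auto simp: image_mono)
  obtain p where p: "bij_betw p {1..n} {1..n}" "\<forall>x\<in>fst ` Z. p x = p3 x"
    using bij_betw_extend[OF p3(1) fZ, of "{1..n}"] cn by auto
  have "p ` fst ` Z = p3 ` fst ` Z" using p(2) by (intro image_cong) auto
  then have pZ: "p ` fst ` Z = {1..card Z}" using p3(1) by (simp add: bij_betw_def)
  have "p ` fst ` X = p3 ` fst ` X" using p(2) assms by (intro image_cong) auto
  also have "\<dots> = p2 ` fst ` X" using p3(2) by (intro image_cong) auto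
  finally have pX: "p ` fst ` X = {1..card X}" using p2(1) by (simp add: bij_betw_def)
  have "p ` fst ` E = p3 ` fst ` E" using p(2) assms by (intro image_cong) auto
  also have "\<dots> = p2 ` fst ` E" using p3(2) assms by (intro image_cong) auto
  also have "\<dots> = p1 ` fst ` E" using p2(2) by (intro image_cong) auto
  finally have pE: "p ` fst ` E = {1..card E}" using p1 by (simp add: bij_betw_def)
  define v where "v x = (if x \<in> fst ` Z then snd (inv_into Z fst x) else 1)" for x
  have vZ: "v (fst z) = snd z" if "z \<in> Z" for z
    using that inv_into_f_f[OF Z'(2) that] by (simp add: v_def)
  have v: "v x \<in> {1..k}" for x
  proof (cases "x \<in> fst ` Z")
    case True
    then have "inv_into Z fst x \<in> {1..n} \<times> {1..k}" using Z'(1) inv_into_into[of x fst Z] by blast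
    then show ?thesis using True by (auto simp: v_def)
  qed (use k in \<open>simp add: v_def\<close>)
  define \<sigma> where "\<sigma> z = (p (fst z), transpose (v (fst z)) 1 (snd z))" for z
  have pinj: "inj_on p {1..n}" and pim: "p ` {1..n} = {1..n}" using p(1) by (simp_all add: bij_betw_def)
  have inj: "inj_on \<sigma> ?U"
  proof (rule inj_onI)
    fix z w assume zw: "z \<in> ?U" "w \<in> ?U" "\<sigma> z = \<sigma> w"
    then have "fst z = fst w" using inj_onD[OF pinj, of "fst z" "fst w"] by (auto simp: \<sigma>_def)
    moreover from this have "snd z = snd w"
      using zw(3) by (metis \<sigma>_def prod.inject transpose_involutory)
    ultimately show "z = w" by (rule prod_eqI)
  qed
  have maps: "\<sigma> ` ?U \<subseteq> ?U"
  proof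
    fix w assume "w \<in> \<sigma> ` ?U"
    then obtain z where z: "z \<in> ?U" "w = \<sigma> z" by blast
    have "fst w \<in> {1..n}" using z pim by (auto simp: \<sigma>_def)
    moreover have "snd w \<in> {1..k}" using z v[of "fst z"] k by (auto simp: \<sigma>_def transpose_def)
    ultimately show "w \<in> ?U" by (cases w) simp
  qed
  have bij: "bij_betw \<sigma> ?U ?U"
    using endo_inj_surj[OF _ maps inj] inj by (simp add: bij_betw_def)
  have signed: "(\<lambda>F. \<sigma> ` F) ` signed_sets n q k = signed_sets n q k" for q
  proof (rule endo_inj_surj[OF finite_signed_sets])
    show "(\<lambda>F. \<sigma> ` F) ` signed_sets n q k \<subseteq> signed_sets n q k"
    proof clarify
      fix F assume "F \<in> signed_sets n q k"
      note F = signed_setsD[OF this]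
      have "inj_on fst (\<sigma> ` F)"
      proof (rule inj_on_imageI, rule inj_onI)
        fix z w assume zw: "z \<in> F" "w \<in> F" "(fst \<circ> \<sigma>) z = (fst \<circ> \<sigma>) w"
        then have "fst z = fst w"
          using F(1) by - (rule inj_onD[OF pinj], auto simp: \<sigma>_def)
        then show "z = w" using zw inj_onD[OF F(2)] by blast
      qed
      moreover have "card (\<sigma> ` F) = q" using F card_image[OF inj_on_subset[OF inj F(1)]] by simp
      ultimately show "\<sigma> ` F \<in> signed_sets n q k" using F(1) maps by (intro signed_setsI) auto
    qed
    show "inj_on (\<lambda>F. \<sigma> ` F) (signed_sets n q k)"
      using inj_on_image_eq_iff[OF inj signed_setsD(1) signed_setsD(1)] by (intro inj_onI) blast
  qed
  have "\<sigma> ` S = (p ` fst ` S) \<times> {1}" if "S \<subseteq> Z" for S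
  proof -
    have "\<sigma> z = (p (fst z), 1)" if "z \<in> S" for z
      using that \<open>S \<subseteq> Z\<close> vZ[of z] by (auto simp: \<sigma>_def)
    then have "\<sigma> ` S = (\<lambda>z. (p (fst z), 1)) ` S" by (intro image_cong) auto
    then show ?thesis by auto
  qed
  then have "\<sigma> ` E = M (card E)" "\<sigma> ` X = M (card X)" "\<sigma> ` Z = M (card Z)"
    using pE pX pZ assms by (simp_all add: M_def)
  then show ?thesis using that bij signed by blast
qed

text \<open>A coordinate-free form of \<open>H1\<close>, with \<open>E\<close> for
  \<open>M t\<close> and \<open>X\<close> for \<open>M l\<close>. The structural arguments produce
  such sets inside the given family; relabelling then moves them into standard position.\<close>

definition H1_on :: "nat \<Rightarrow> nat \<Rightarrow> nat \<Rightarrow> nat \<Rightarrow> (nat \<times> nat) set \<Rightarrow> (nat \<times> nat) set \<Rightarrow> (nat \<times> nat) set set" where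
  "H1_on n r k t E X = {F \<in> signed_sets n r k.
     (E \<subseteq> F \<and> card (F \<inter> X) \<ge> t + 1) \<or> (\<not> E \<subseteq> F \<and> card (F \<inter> X) = card X - 1)}"

text \<open>The same for \<open>H2\<close>: \<open>X\<close> stands for \<open>M r\<close> and
  \<open>Y\<close> for \<open>M c - M r\<close>.\<close>

definition H2_on :: "nat \<Rightarrow> nat \<Rightarrow> nat \<Rightarrow> nat \<Rightarrow> (nat \<times> nat) set \<Rightarrow> (nat \<times> nat) set \<Rightarrow> (nat \<times> nat) set
    \<Rightarrow> (nat \<times> nat) set set" where
  "H2_on n r k t E X Y = {F \<in> signed_sets n r k.
     (E \<subseteq> F \<and> card (F \<inter> X) \<ge> t + 1) \<or> (F \<inter> X = E \<and> Y \<subseteq> F) \<or>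
     (\<not> E \<subseteq> F \<and> card (F \<inter> X) = r - 1 \<and> card (F \<inter> Y) = 1)}"

lemma image_Collect_invariant:
  assumes "h ` A = A" "\<And>x. x \<in> A \<Longrightarrow> P x \<longleftrightarrow> Q (h x)"
  shows "{y \<in> A. Q y} = h ` {x \<in> A. P x}"
  using assms by (smt (verit) Collect_cong image_def mem_Collect_eq)

lemma H1_on_iso:
  assumes X: "X \<in> signed_sets n l k" and E: "E \<subseteq> X" "card E = t" and "k \<ge> 1"
  shows "family_iso n k (H1_on n r k t E X) (H1 n r k l t)"
proof -
  obtain \<sigma> where \<sigma>: "bij_betw \<sigma> ({1..n} \<times> {1..k}) ({1..n} \<times> {1..k})"
    "\<forall>q. (\<lambda>F. \<sigma> ` F) ` signed_sets n q k = signed_sets n q k"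
    "\<sigma> ` E = M (card E)" "\<sigma> ` X = M (card X)"
    using signed_set_relabelling[OF X E(1) order_refl assms(4)] by metis
  have inj: "inj_on \<sigma> ({1..n} \<times> {1..k})" using \<sigma>(1) by (simp add: bij_betw_def)
  note X' = signed_setsD[OF X]
  have EU: "E \<subseteq> {1..n} \<times> {1..k}" using E X'(1) by simp
  have "H1 n r k l t = (\<lambda>F. \<sigma> ` F) ` H1_on n r k t E X"
    unfolding H1_def H1_on_def
  proof (rule image_Collect_invariant[OF \<sigma>(2)[rule_format]])
    fix F assume "F \<in> signed_sets n r k"
    note F = signed_setsD[OF this]
    have "E \<subseteq> F \<longleftrightarrow> M t \<subseteq> \<sigma> ` F"
      using inj_on_image_subset_iff'[OF inj EU F(1)] \<sigma>(3) E by simp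
    moreover have "\<sigma> ` F \<inter> M l = \<sigma> ` (F \<inter> X)"
      using inj_on_image_Int[OF inj F(1) X'(1)] \<sigma>(4) X'(3) by simp
    moreover have "card (\<sigma> ` (F \<inter> X)) = card (F \<inter> X)"
      by (rule card_image, rule inj_on_subset[OF inj]) (use F(1) in blast)
    ultimately show "(E \<subseteq> F \<and> t + 1 \<le> card (F \<inter> X) \<or> \<not> E \<subseteq> F \<and> card (F \<inter> X) = card X - 1) =
       (M t \<subseteq> \<sigma> ` F \<and> t + 1 \<le> card (\<sigma> ` F \<inter> M l) \<or> \<not> M t \<subseteq> \<sigma> ` F \<and> card (\<sigma> ` F \<inter> M l) = l - 1)"
      using X'(3) by simp
  qed
  then show ?thesis unfolding family_iso_def using \<sigma>(1) by blast
qed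

lemma H2_on_iso:
  assumes Z: "X \<union> Y \<in> signed_sets n c k" and "X \<inter> Y = {}" "card X = r"
    and E: "E \<subseteq> X" "card E = t" and "k \<ge> 1"
  shows "family_iso n k (H2_on n r k t E X Y) (H2 n r k c t)"
proof -
  obtain \<sigma> where \<sigma>: "bij_betw \<sigma> ({1..n} \<times> {1..k}) ({1..n} \<times> {1..k})"
    "\<forall>q. (\<lambda>F. \<sigma> ` F) ` signed_sets n q k = signed_sets n q k"
    "\<sigma> ` E = M (card E)" "\<sigma> ` X = M (card X)" "\<sigma> ` (X \<union> Y) = M (card (X \<union> Y))"
    using signed_set_relabelling[OF Z E(1) Un_upper1 assms(6)] by metis
  have inj: "inj_on \<sigma> ({1..n} \<times> {1..k})" using \<sigma>(1) by (simp add: bij_betw_def)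
  note Z' = signed_setsD[OF Z]
  have U: "E \<subseteq> {1..n} \<times> {1..k}" "X \<subseteq> {1..n} \<times> {1..k}" "Y \<subseteq> {1..n} \<times> {1..k}"
    using E Z'(1) by auto
  have "M c - M r = \<sigma> ` (X \<union> Y) - \<sigma> ` X" using \<sigma>(4,5) Z'(3) assms(3) by simp
  also have "\<dots> = \<sigma> ` (X \<union> Y - X)" using inj_on_image_set_diff[OF inj, of "X \<union> Y" X] U by auto
  also have "X \<union> Y - X = Y" using assms(2) by blast
  finally have Y: "M c - M r = \<sigma> ` Y" .
  have "H2 n r k c t = (\<lambda>F. \<sigma> ` F) ` H2_on n r k t E X Y"
    unfolding H2_def H2_on_def
  proof (rule image_Collect_invariant[OF \<sigma>(2)[rule_format]])
    fix F assume "F \<in> signed_sets n r k"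
    note F = signed_setsD[OF this]
    have "E \<subseteq> F \<longleftrightarrow> M t \<subseteq> \<sigma> ` F"
      using inj_on_image_subset_iff'[OF inj U(1) F(1)] \<sigma>(3) E by simp
    moreover have "Y \<subseteq> F \<longleftrightarrow> \<sigma> ` Y \<subseteq> \<sigma> ` F"
      using inj_on_image_subset_iff'[OF inj U(3) F(1)] by simp
    moreover have X: "\<sigma> ` F \<inter> M r = \<sigma> ` (F \<inter> X)"
      using inj_on_image_Int[OF inj F(1) U(2)] \<sigma>(4) assms(3) by simp
    moreover have "\<sigma> ` F \<inter> \<sigma> ` Y = \<sigma> ` (F \<inter> Y)"
      using inj_on_image_Int[OF inj F(1) U(3)] by simp
    moreover have "card (\<sigma> ` (F \<inter> S)) = card (F \<inter> S)" for S
      using F(1) by (intro card_image inj_on_subset[OF inj]) blast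
    moreover have "F \<inter> X = E \<longleftrightarrow> \<sigma> ` F \<inter> M r = M t"
      using inj_on_image_eq_iff[OF inj, of "F \<inter> X" E] F(1) U(1) X \<sigma>(3) E by auto
    ultimately show "(E \<subseteq> F \<and> t + 1 \<le> card (F \<inter> X) \<or> F \<inter> X = E \<and> Y \<subseteq> F \<or>
        \<not> E \<subseteq> F \<and> card (F \<inter> X) = r - 1 \<and> card (F \<inter> Y) = 1) =
       (M t \<subseteq> \<sigma> ` F \<and> t + 1 \<le> card (\<sigma> ` F \<inter> M r) \<or> \<sigma> ` F \<inter> M r = M t \<and> M c - M r \<subseteq> \<sigma> ` F \<or>
        \<not> M t \<subseteq> \<sigma> ` F \<and> card (\<sigma> ` F \<inter> M r) = r - 1 \<and> card (\<sigma> ` F \<inter> (M c - M r)) = 1)"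
      unfolding Y by simp
  qed
  then show ?thesis unfolding family_iso_def using \<sigma>(1) by blast
qed

text \<open>The bijection of points need not respect signed sets, but injectivity suffices for
  counting, and the size is all that the converse direction takes from the isomorphism.\<close>

lemma family_iso_card:
  assumes "family_iso n k \<F> \<G>" "\<F> \<subseteq> signed_sets n r k"
  shows "card \<F> = card \<G>"
proof -
  obtain \<sigma> where \<sigma>: "bij_betw \<sigma> ({1..n} \<times> {1..k}) ({1..n} \<times> {1..k})" "\<G> = (\<lambda>F. \<sigma> ` F) ` \<F>"
    using assms(1) by (auto simp: family_iso_def)
  have "inj_on (\<lambda>F. \<sigma> ` F) \<F>"
    using inj_on_image_eq_iff[OF bij_betw_imp_inj_on[OF \<sigma>(1)] signed_setsD(1) signed_setsD(1)] assms(2)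
    by (intro inj_onI) blast
  then show ?thesis using \<sigma>(2) by (simp add: card_image)
qed

section \<open>The numerical comparisons\<close>

text \<open>Here \<open>s\<close> stands for \<open>r - t\<close> and \<open>B\<close> for the ratio of the numbers of members of
  \<open>signed_sets n r k\<close> containing a given signed set of size \<open>t + 2\<close> and one of size \<open>t + 1\<close>;
  the two bounds on \<open>B\<close> come from \<open>k \<ge> g n r t\<close>.\<close>

lemma ratio_bounds:
  fixes s t B :: real
  assumes "s \<ge> 2" "t \<ge> 1" "B \<ge> 0" "B * (s + 3) * ((t + 1) * (t + 2)) \<le> 2"
  shows "3 * (B * (s + 3) * (t + 1)) \<le> 2" "3 * (B * (s + 3)) \<le> 1"
proof -
  have "(B * (s + 3) * (t + 1)) * 3 \<le> (B * (s + 3) * (t + 1)) * (t + 2)"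
    using assms by (intro mult_left_mono) auto
  then show 1: "3 * (B * (s + 3) * (t + 1)) \<le> 2" using assms(4) by (simp add: mult_ac)
  have "(B * (s + 3)) * 2 \<le> (B * (s + 3)) * (t + 1)"
    using assms by (intro mult_left_mono) auto
  then show "3 * (B * (s + 3)) \<le> 1" using 1 by simp
qed

text \<open>The left side is the bound for a family without covers of size \<open>t + 1\<close>, the
  right side is \<open>f\<close>, both divided by the size of a star over a
  \<open>(t + 1)\<close>-set. Multiplying by \<open>(s + 3) * (s + 1)\<close> lets both bounds on
  \<open>B\<close> be inserted.\<close>

lemma compare_no_small_cover:
  fixes s t B :: real
  assumes "s \<ge> 2" "t \<ge> 1" "B \<ge> 0"
    and "B * (s + 3) * ((t + 1) * (t + 2)) \<le> 2" "B * (s + 3) * (s + 1) \<le> 2"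
  shows "(t + 2) * (t + 1) / 2 * (s + 1)^2 * B < s - s * (s - 1) / 2 * B"
proof -
  have "((t + 2) * (t + 1) / 2 * (s + 1)^2 * B) * ((s + 3) * (s + 1))
      = (s + 1)^3 / 2 * (B * (s + 3) * ((t + 1) * (t + 2)))"
    by (simp add: power2_eq_square power3_eq_cube field_simps)
  also have "\<dots> \<le> (s + 1)^3 / 2 * 2"
    using assms by (intro mult_left_mono) auto
  finally have 1: "((t + 2) * (t + 1) / 2 * (s + 1)^2 * B) * ((s + 3) * (s + 1)) \<le> (s + 1)^3" by simp
  have "(s * (s - 1) / 2 * B) * ((s + 3) * (s + 1)) = s * (s - 1) / 2 * (B * (s + 3) * (s + 1))"
    by (simp add: field_simps)
  also have "\<dots> \<le> s * (s - 1) / 2 * 2"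
    using assms by (intro mult_left_mono) auto
  finally have 2: "(s * (s - 1) / 2 * B) * ((s + 3) * (s + 1)) \<le> s * (s - 1)" by simp
  have "(s + 1)^3 + s * (s - 1) < s * ((s + 3) * (s + 1))"
    using assms by (simp add: power3_eq_cube algebra_simps)
  then have "((t + 2) * (t + 1) / 2 * (s + 1)^2 * B + s * (s - 1) / 2 * B) * ((s + 3) * (s + 1))
      < s * ((s + 3) * (s + 1))"
    using 1 2 by (simp only: distrib_right)
  moreover have "(s + 3) * (s + 1) > 0" using assms by simp
  ultimately have "(t + 2) * (t + 1) / 2 * (s + 1)^2 * B + s * (s - 1) / 2 * B < s"
    by (metis mult_less_cancel_right_pos)
  then show ?thesis by simp
qed

text \<open>For \<open>card D = 1\<close>: one full star, \<open>s * (s + 1)\<close> smaller ones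
  from members through \<open>E\<close> avoiding \<open>D\<close>, and
  \<open>t * s * (s + 1)\<close> from members not containing \<open>E\<close>.\<close>

lemma compare_one_point:
  fixes s t B :: real
  assumes "s \<ge> 2" "t \<ge> 1" "B \<ge> 0"
    and "B * (s + 3) * ((t + 1) * (t + 2)) \<le> 2" "B * (s + 3) * (s + 1) \<le> 2"
  shows "1 + (t + 1) * s * (s + 1) * B < s - s * (s - 1) / 2 * B"
proof -
  note R = ratio_bounds[OF assms(1-4)]
  have "((t + 1) * s * (s + 1) * B) * ((s + 3) * (s + 1))
      = s * (s + 1)^2 / 3 * (3 * (B * (s + 3) * (t + 1)))"
    by (simp add: power2_eq_square field_simps)
  also have "\<dots> \<le> s * (s + 1)^2 / 3 * 2"
    using assms R by (intro mult_left_mono) auto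
  finally have 1: "((t + 1) * s * (s + 1) * B) * ((s + 3) * (s + 1)) \<le> s * (s + 1)^2 / 3 * 2" .
  have "(s * (s - 1) / 2 * B) * ((s + 3) * (s + 1)) = s * (s - 1) / 2 * (B * (s + 3) * (s + 1))"
    by (simp add: field_simps)
  also have "\<dots> \<le> s * (s - 1) / 2 * 2"
    using assms by (intro mult_left_mono) auto
  finally have 2: "(s * (s - 1) / 2 * B) * ((s + 3) * (s + 1)) \<le> s * (s - 1)" by simp
  \<comment> \<open>Shifting the variable to start at 0 makes all coefficients of the difference
    polynomial positive.\<close>
  define w where "w = s - 2"
  have w: "w \<ge> 0" "s = w + 2" using assms by (simp_all add: w_def)
  have "(s - 1) * ((s + 3) * (s + 1)) - s * (s + 1)^2 / 3 * 2 - s * (s - 1)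
      = w^3 / 3 + (8/3) * w^2 + 6 * w + 1"
    unfolding w by (simp add: power2_eq_square power3_eq_cube field_simps)
  moreover have "w^3 \<ge> 0" "w^2 \<ge> 0" using w by simp_all
  ultimately have "s * (s + 1)^2 / 3 * 2 + s * (s - 1) < (s - 1) * ((s + 3) * (s + 1))"
    using w by linarith
  then have "((t + 1) * s * (s + 1) * B + s * (s - 1) / 2 * B) * ((s + 3) * (s + 1))
      < (s - 1) * ((s + 3) * (s + 1))"
    using 1 2 by (simp only: distrib_right)
  moreover have "(s + 3) * (s + 1) > 0" using assms by simp
  ultimately have "(t + 1) * s * (s + 1) * B + s * (s - 1) / 2 * B < s - 1"
    by (metis mult_less_cancel_right_pos)
  then show ?thesis by simp
qed

text \<open>For \<open>card D = 2\<close>; there \<open>card D < s\<close> supplies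
  \<open>s \<ge> 3\<close>.\<close>

lemma compare_two_points:
  fixes s t B :: real
  assumes "s \<ge> 3" "t \<ge> 1" "B \<ge> 0"
    and "B * (s + 3) * ((t + 1) * (t + 2)) \<le> 2" "B * (s + 3) * (s + 1) \<le> 2"
  shows "2 + ((s - 1) * (s + 1) + t * (s + 1)) * B < s - s * (s - 1) / 2 * B"
proof -
  have s2: "s \<ge> 2" using assms by simp
  note R = ratio_bounds[OF s2 assms(2-4)]
  define b where "b = B * (s + 3)"
  have b: "b \<ge> 0" "3 * b \<le> 1" "3 * (b * (t + 1)) \<le> 2" using R assms by (simp_all add: b_def)
  have "(((s - 1) * (s + 1) + t * (s + 1)) * B + s * (s - 1) / 2 * B) * (s + 3)
      = (s - 2) * (s + 1) * b + (s + 1) * (b * (t + 1)) + s * (s - 1) / 2 * b"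
    unfolding b_def by (simp add: field_simps)
  also have "(s - 2) * (s + 1) * b \<le> (s - 2) * (s + 1) * (1/3)"
    using s2 b by (intro mult_left_mono) auto
  also have "(s + 1) * (b * (t + 1)) \<le> (s + 1) * (2/3)"
    using s2 b by (intro mult_left_mono) auto
  also have "s * (s - 1) / 2 * b \<le> s * (s - 1) / 2 * (1/3)"
    using s2 b by (intro mult_left_mono) auto
  finally have 1: "(((s - 1) * (s + 1) + t * (s + 1)) * B + s * (s - 1) / 2 * B) * (s + 3)
     \<le> (s - 2) * (s + 1) * (1/3) + (s + 1) * (2/3) + s * (s - 1) / 2 * (1/3)" by simp
  define w where "w = s - 3"
  have w: "w \<ge> 0" "s = w + 3" using assms by (simp_all add: w_def)
  have "(s - 2) * (s + 3) - ((s - 2) * (s + 1) * (1/3) + (s + 1) * (2/3) + s * (s - 1) / 2 * (1/3))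
      = w^2 / 2 + (23/6) * w + 1"
    unfolding w by (simp add: power2_eq_square field_simps)
  moreover have "w^2 \<ge> 0" by simp
  ultimately have "(((s - 1) * (s + 1) + t * (s + 1)) * B + s * (s - 1) / 2 * B) * (s + 3) < (s - 2) * (s + 3)"
    using 1 w by linarith
  moreover have "s + 3 > 0" using assms by simp
  ultimately have "((s - 1) * (s + 1) + t * (s + 1)) * B + s * (s - 1) / 2 * B < s - 2"
    by (metis mult_less_cancel_right_pos)
  then show ?thesis by simp
qed

text \<open>Applied with \<open>p = card D\<close> when this is at least 3, where each of the
  \<open>t\<close> choices of the missing point of \<open>E\<close> costs a single smaller
  star.\<close>

lemma compare_many_points:
  fixes s t p B :: real
  assumes "s \<ge> 2" "t \<ge> 1" "B \<ge> 0" "p \<le> s - 1"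
    and "B * (s + 3) * ((t + 1) * (t + 2)) \<le> 2" "B * (s + 3) * (s + 1) \<le> 2"
  shows "p + ((s + 1 - p) * (s + 1) + t) * B < s - s * (s - 1) / 2 * B"
proof -
  note R = ratio_bounds[OF assms(1-3,5)]
  have "B * (s + 1) \<le> B * (s + 3)" using assms by (intro mult_left_mono) auto
  then have "B * (s + 1) \<le> 1" using R(2) by simp
  \<comment> \<open>The worst case is \<open>p = s - 1\<close>: raising \<open>p\<close> by 1 adds 1
    and saves only \<open>B * (s + 1) \<le> 1\<close>.\<close>
  have "(s - 1 - p) * (B * (s + 1)) \<le> (s - 1 - p) * 1"
    using assms \<open>B * (s + 1) \<le> 1\<close> by (intro mult_left_mono) auto
  then have 1: "p + ((s + 1 - p) * (s + 1) + t) * B \<le> s - 1 + (2 * (s + 1) + t) * B"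
    by (simp add: algebra_simps)
  define c where "c = 2 * (s + 1) + t + s * (s - 1) / 2"
  have "c * B < 1"
  proof (cases "B = 0")
    case False
    then have B: "B > 0" using assms(3) by simp
    show ?thesis
    \<comment> \<open>The split decides which of the two bounds on \<open>B\<close> is the stronger
      one.\<close>
    proof (cases "s + 1 \<le> (t + 1) * (t + 2)")
      case True
      have "(t + 1) * (t + 2) \<ge> 4 * t + 2"
        using mult_nonneg_nonneg[of t "t - 1"] assms(2) by (simp add: algebra_simps)
      then have "2 * t \<le> (t + 1) * (t + 2) / 2 - 1" by simp
      moreover have "(s + 5/2) * (s + 1) \<le> (s + 5/2) * ((t + 1) * (t + 2))"
        using True assms(1) by (intro mult_left_mono) auto
      moreover have "2 * c = s^2 + 3 * s + 4 + 2 * t" "(s + 5/2) * (s + 1) = s^2 + 7/2 * s + 5/2"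
        by (simp_all add: c_def power2_eq_square field_simps)
      moreover have "(s + 3) * ((t + 1) * (t + 2)) = (s + 5/2) * ((t + 1) * (t + 2)) + (t + 1) * (t + 2) / 2"
        by (simp only: distrib_right)
      ultimately have "2 * c < (s + 3) * ((t + 1) * (t + 2))" using assms(1) by linarith
      from mult_strict_left_mono[OF this B] show ?thesis using assms(5) by (simp add: mult_ac)
    next
      case False
      then have "s > t * t + 3 * t + 1" by (simp add: algebra_simps)
      moreover have "t * t \<ge> 0" by simp
      ultimately have "s > 2 * t + 1" using assms(2) by linarith
      moreover have "2 * c = s * s + 3 * s + 4 + 2 * t" by (simp add: c_def field_simps)
      ultimately have "2 * c < (s + 3) * (s + 1)" by (simp add: algebra_simps)
      from mult_strict_left_mono[OF this B] show ?thesis using assms(6) by (simp add: mult_ac)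
    qed
  qed simp
  then show ?thesis using 1 by (simp add: c_def algebra_simps)
qed

text \<open>The pair correction is below 1, so the right side exceeds \<open>s - 1\<close>.\<close>

lemma compare_triangle_large:
  fixes s t B :: real
  assumes "s \<ge> t + 3" "t \<ge> 1" "B \<ge> 0" "B * (s + 3) * (s + 1) \<le> 2"
  shows "t + 2 < s - s * (s - 1) / 2 * B"
proof -
  have "s * (s - 1) / 2 * B < 1"
  proof (cases "B = 0")
    case False
    then have "B * (s * (s - 1)) < B * ((s + 3) * (s + 1))"
      using assms by (intro mult_strict_left_mono) (auto simp: algebra_simps)
    then show ?thesis using assms(4) by (simp add: mult_ac)
  qed simp
  then show ?thesis using assms(1) by simp
qed

text \<open>At \<open>s = t + 2\<close> both sides agree. Below that, the correction on the right is
  at most 1, which the gap between \<open>s\<close> and \<open>t + 2\<close> absorbs.\<close>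

lemma compare_triangle_small:
  fixes s t B :: real
  assumes "s \<le> t + 1 \<or> s = t + 2" "s \<ge> 1" "t \<ge> 1" "B \<ge> 0" "B * (s + 3) * ((t + 1) * (t + 2)) \<le> 2"
  shows "s - s * (s - 1) / 2 * B \<le> (t + 2) - (t + 2) * (t + 1) / 2 * B"
proof (cases "s = t + 2")
  case True
  then show ?thesis by (simp add: algebra_simps)
next
  case False
  have "(t + 2) * (t + 1) / 2 * B * 2 \<le> B * (s + 3) * ((t + 1) * (t + 2))"
    using assms(2-4) mult_right_mono[of 1 "s + 3" "B * ((t + 1) * (t + 2))"] by (simp add: algebra_simps)
  moreover have "s * (s - 1) / 2 * B \<ge> 0" using assms by simp
  ultimately show ?thesis using assms False by linarith
qed

section \<open>Maximal non-trivial families and their covers\<close>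

lemma card_Int_lower:
  assumes "finite X"
  shows "card (F \<inter> X) + card (G \<inter> X) \<le> card (F \<inter> G \<inter> X) + card X"
proof -
  have "card (F \<inter> X) + card (G \<inter> X) = card (F \<inter> X \<union> G \<inter> X) + card (F \<inter> X \<inter> (G \<inter> X))"
    using assms by (intro card_Un_Int) auto
  moreover have "card (F \<inter> X \<union> G \<inter> X) \<le> card X" using assms by (intro card_mono) auto
  moreover have "F \<inter> X \<inter> (G \<inter> X) = F \<inter> G \<inter> X" by blast
  ultimately show ?thesis by simp
qed

lemma card_not_subset_Int: "finite E \<Longrightarrow> \<not> E \<subseteq> F \<Longrightarrow> card (E \<inter> F) < card E"
  by (intro psubset_card_mono) auto

text \<open>\<open>S\<close> uses at most one value per coordinate, so with \<open>k \<ge> 2\<close>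
  one of the values 1 and 2 avoids it on every new coordinate.\<close>

lemma signed_extension:
  assumes T: "T \<in> signed_sets n q k" and S: "S \<in> signed_sets n q' k"
    and "q \<le> r" "r \<le> n" "2 \<le> k"
  obtains G where "G \<in> signed_sets n r k" "T \<subseteq> G" "G \<inter> S \<subseteq> T"
proof -
  note T' = signed_setsD[OF T] and S' = signed_setsD[OF S]
  have "card ({1..n} - fst ` T) = n - q"
    using T' by (subst card_Diff_subset) (auto simp: card_image)
  then obtain A where A: "A \<subseteq> {1..n} - fst ` T" "card A = r - q" "finite A"
    using assms obtain_subset_with_card_n[of "r - q" "{1..n} - fst ` T"]
    by (metis diff_le_mono finite_Diff finite_atLeastAtMost finite_subset)
  define h where "h x = (x, if (x, 1::nat) \<in> S then 2 else 1::nat)" for x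
  have hS: "h x \<notin> S" for x
    using inj_onD[OF S'(2), of "(x, 1)" "(x, 2)"] by (auto simp: h_def)
  have fsth: "fst (h x) = x" for x by (simp add: h_def)
  have hU: "h ` A \<subseteq> {1..n} \<times> {1..k}" using A assms by (auto simp: h_def)
  have disj: "T \<inter> h ` A = {}"
  proof (rule ccontr)
    assume "T \<inter> h ` A \<noteq> {}"
    then obtain x where x: "x \<in> A" "h x \<in> T" by blast
    then have "x \<in> fst ` T" using fsth[of x] by (metis image_eqI)
    then show False using x(1) A(1) by blast
  qed
  have "inj_on h A" by (metis fsth inj_onI)
  then have "card (T \<union> h ` A) = r"
    using A T' disj assms by (simp add: card_Un_disjoint card_image)
  moreover have "inj_on fst (T \<union> h ` A)"
  proof -
    have "inj_on fst (h ` A)" by (rule inj_on_imageI) (simp add: inj_on_def fsth)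
    moreover have "fst ` h ` A = A" by (simp add: image_image fsth)
    ultimately show ?thesis using T'(2) A(1) by (auto simp: inj_on_Un)
  qed
  moreover have "T \<union> h ` A \<subseteq> {1..n} \<times> {1..k}" using T'(1) hU by simp
  ultimately have "T \<union> h ` A \<in> signed_sets n r k" by (intro signed_setsI)
  moreover have "(T \<union> h ` A) \<inter> S \<subseteq> T" using hS by auto
  ultimately show ?thesis by (intro that[of "T \<union> h ` A"]) auto
qed

text \<open>The binomial is the product of the factors \<open>(a + i) / i\<close> for
  \<open>i\<close> from 1 to \<open>j\<close>, each at most \<open>a + 1\<close>.\<close>

lemma binomial_le_power: "(a + j) choose j \<le> (a + 1) ^ j"
proof (induction j)
  case (Suc j)
  have "Suc j * ((a + Suc j) choose Suc j) = (a + Suc j) * ((a + j) choose j)"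
    using Suc_times_binomial[of j "a + j"] by simp
  also have "\<dots> \<le> (Suc j * (a + 1)) * (a + 1) ^ j"
    using Suc.IH by (intro mult_le_mono) (simp_all add: algebra_simps)
  finally have "Suc j * ((a + Suc j) choose Suc j) \<le> Suc j * ((a + 1) ^ Suc j)" by (simp only: mult_ac power_Suc)
  then show ?case by (simp only: mult_le_cancel1)
qed simp

locale maximal_nontrivial_family =
  fixes n r k t :: nat and \<F> :: "(nat \<times> nat) set set"
  assumes k: "2 \<le> k" and t: "1 \<le> t" and tr: "t + 1 \<le> r" and rn: "r \<le> n" and tn: "t + 2 \<le> n"
    and max: "maximal_t_intersecting n r k t \<F>"
    and nontrivial: "\<not> trivial_family n k t \<F>"
begin

definition cover :: "(nat \<times> nat) set \<Rightarrow> bool" where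
  "cover T \<longleftrightarrow> (\<forall>F\<in>\<F>. t \<le> card (T \<inter> F))"

text \<open>The size \<open>t + 1\<close> is the least that a signed cover can have: one of size
  \<open>t\<close> would lie in every member, against non-triviality.\<close>

definition covers :: "(nat \<times> nat) set set" where
  "covers = {T \<in> signed_sets n (t + 1) k. cover T}"

abbreviation star :: "(nat \<times> nat) set \<Rightarrow> (nat \<times> nat) set set" where
  "star S \<equiv> {F \<in> \<F>. S \<subseteq> F}"

abbreviation N :: "nat \<Rightarrow> nat" where
  "N \<equiv> star_size n r k"

lemma subset_signed: "\<F> \<subseteq> signed_sets n r k"
  using max by (simp add: maximal_t_intersecting_def)

lemma finite_family: "finite \<F>"
  using subset_signed finite_signed_sets by (rule finite_subset)

lemma mem:
  assumes "F \<in> \<F>"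
  shows "F \<in> signed_sets n r k" "card F = r" "finite F"
  using assms subset_signed signed_setsD(3,4)[of F n r k] by auto

lemma inter: "F \<in> \<F> \<Longrightarrow> G \<in> \<F> \<Longrightarrow> t \<le> card (F \<inter> G)"
  using max by (simp add: maximal_t_intersecting_def t_intersecting_def)

lemma maximal_eq:
  "\<F> \<subseteq> \<G> \<Longrightarrow> \<G> \<subseteq> signed_sets n r k \<Longrightarrow> t_intersecting t \<G> \<Longrightarrow> \<F> = \<G>"
  using max unfolding maximal_t_intersecting_def by blast

lemma not_all: "E \<in> signed_sets n t k \<Longrightarrow> \<exists>F\<in>\<F>. \<not> E \<subseteq> F"
  using nontrivial by (auto simp: trivial_family_def signed_sets_def)

lemma nonempty: "\<F> \<noteq> {}"
proof -
  have "{1..t} \<times> {1} \<in> signed_sets n t k"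
    using tn k by (intro signed_setsI) (auto simp: inj_on_def card_cartesian_product)
  then show ?thesis using not_all by blast
qed

lemma card_star_bound: "card (star S) \<le> N (card S)"
  using subset_signed by (rule card_star_le)

text \<open>Adding \<open>G\<close> keeps the family \<open>t\<close>-intersecting, so maximality
  forces \<open>G\<close> in. This turns a cover into a full star of members.\<close>

lemma cover_star:
  assumes "cover S" "G \<in> signed_sets n r k" "S \<subseteq> G"
  shows "G \<in> \<F>"
proof -
  note G = signed_setsD[OF assms(2)]
  have le: "t \<le> card (G \<inter> F)" if "F \<in> \<F>" for F
  proof -
    have "t \<le> card (S \<inter> F)" using assms(1) that by (simp add: cover_def)
    also have "\<dots> \<le> card (G \<inter> F)" using assms(3) G(4) by (intro card_mono) auto
    finally show ?thesis .
  qed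
  have "t_intersecting t (insert G \<F>)"
    unfolding t_intersecting_def
  proof (intro ballI)
    fix F F' assume "F \<in> insert G \<F>" "F' \<in> insert G \<F>"
    then show "t \<le> card (F \<inter> F')"
      using le inter G(3) tr by (auto simp: Int_commute)
  qed
  then have "\<F> = insert G \<F>" using assms(2) subset_signed by (intro maximal_eq) auto
  then show ?thesis by blast
qed

lemma coversD:
  assumes "T \<in> covers"
  shows "T \<in> signed_sets n (t + 1) k" "cover T" "card T = t + 1" "finite T"
  using assms signed_setsD[of T n "t + 1" k] by (auto simp: covers_def)

text \<open>Extend \<open>T\<close> to an \<open>r\<close>-set that gains no point of
  \<open>S\<close>. It is a member, so the cover \<open>S\<close> meets it in \<open>t\<close>
  points, all of them in \<open>T\<close>.\<close>

lemma covers_inter: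
  assumes "T \<in> covers" "S \<in> covers"
  shows "t \<le> card (T \<inter> S)"
proof -
  note T = coversD[OF assms(1)] and S = coversD[OF assms(2)]
  obtain G where G: "G \<in> signed_sets n r k" "T \<subseteq> G" "G \<inter> S \<subseteq> T"
    using signed_extension[OF T(1) S(1) tr rn k] by blast
  then have "G \<in> \<F>" using cover_star T(2) by blast
  then have "t \<le> card (S \<inter> G)" using S(2) by (simp add: cover_def)
  also have "\<dots> \<le> card (T \<inter> S)" using G(3) T(4) by (intro card_mono) auto
  finally show ?thesis .
qed

text \<open>A member containing \<open>S\<close> must meet \<open>G\<close> in one more point than
  \<open>S\<close> does, and \<open>G - S\<close> has \<open>r - (t - 1)\<close> points.\<close>

lemma card_star_step:
  assumes "finite S" "G \<in> \<F>" "card (S \<inter> G) < t" "t \<le> card (S \<inter> G) + 1"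
  shows "card (star S) \<le> (r - t + 1) * N (card S + 1)"
proof -
  note G = mem[OF assms(2)]
  have "card (G - S) = r - t + 1"
    using assms G tr by (simp add: card_Diff_subset_Int Int_commute)
  moreover have "star S \<subseteq> (\<Union>z\<in>G - S. star (insert z S))"
  proof
    fix F assume F: "F \<in> star S"
    have "\<not> F \<inter> G \<subseteq> S \<inter> G"
      using inter[of F G] F assms card_mono[of "S \<inter> G" "F \<inter> G"] by auto
    then show "F \<in> (\<Union>z\<in>G - S. star (insert z S))" using F by blast
  qed
  moreover have "card (star (insert z S)) \<le> N (card S + 1)" if "z \<in> G - S" for z
    using card_star_bound[of "insert z S"] that assms(1) by simp
  ultimately show ?thesis
    using card_le_card_times[of "G - S" "star S" "\<lambda>z. star (insert z S)" "N (card S + 1)"] G(3) finite_family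
    by simp
qed

text \<open>If \<open>card (U \<inter> G) = t - j\<close> then members containing \<open>U\<close> contain \<open>j\<close> points of \<open>G - U\<close>,
  which has \<open>r - t + j\<close> points, and \<open>(r - t + j) choose j \<le> (r - t + 1)^j\<close>.\<close>

lemma star_weighted:
  assumes min: "\<And>S. S \<in> signed_sets n (card S) k \<Longrightarrow> cover S \<Longrightarrow> m \<le> card S"
    and mono: "\<And>q. m \<le> q \<Longrightarrow> (r - t + 1) * N (Suc q) \<le> N q"
    and "finite U"
  shows "(r - t + 1) ^ card U * card (star U) \<le> (r - t + 1) ^ m * N m"
  using assms(3)
proof (induction "m - card U" arbitrary: U rule: less_induct)
  case less
  let ?c = "r - t + 1"
  show ?case
  proof (cases "m \<le> card U")
    case True
    have "?c ^ q * N q \<le> ?c ^ m * N m" if "m \<le> q" for q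
      using that
    proof (induction q rule: dec_induct)
      case (step q)
      have "?c ^ Suc q * N (Suc q) = ?c ^ q * (?c * N (Suc q))" by (simp only: power_Suc mult_ac)
      also have "\<dots> \<le> ?c ^ q * N q" using mono[OF step.hyps(1)] by (rule mult_le_mono2)
      finally show ?case using step.IH by (rule order_trans)
    qed simp
    from this[OF True] show ?thesis
      using mult_le_mono2[OF card_star_bound[of U]] order_trans by blast
  next
    case False
    show ?thesis
    proof (cases "star U = {}")
      case True
      then have "card (star U) = 0" by (simp only: card.empty)
      then show ?thesis by (simp only: mult_0_right le0)
    next
      case nonempty: False
      then obtain F where F: "F \<in> \<F>" "U \<subseteq> F" by blast
      have "U \<in> signed_sets n (card U) k" using signed_sets_subset[OF mem(1)[OF F(1)] F(2)] .
      \<comment> \<open>\<open>U\<close> lies in a member, hence is signed, and it is smaller than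
        every signed cover.\<close>
      then have "\<not> cover U" using min False by blast
      then obtain G where G: "G \<in> \<F>" "card (U \<inter> G) < t" by (auto simp: cover_def not_le)
      define j where "j = t - card (U \<inter> G)"
      define \<J> where "\<J> = {J. J \<subseteq> G - U \<and> card J = j}"
      have finG: "finite G" using mem G by blast
      have fin\<J>: "finite \<J>" using finG by (simp add: \<J>_def)
      have "card (G - U) = r - t + j"
        using mem(2,3)[OF G(1)] G(2) tr by (simp add: j_def card_Diff_subset_Int Int_commute)
      then have c\<J>: "card \<J> \<le> ?c ^ j"
        using n_subsets[of "G - U" j] finG binomial_le_power[of "r - t" j] by (simp add: \<J>_def)
      have sub: "star U \<subseteq> (\<Union>J\<in>\<J>. star (U \<union> J))"
      proof
        fix F assume F: "F \<in> star U"
        have "card (F \<inter> G) - card (U \<inter> G) \<le> card (F \<inter> G - U \<inter> G)"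
          using finG by (intro diff_card_le_card_Diff) simp
        moreover have "t \<le> card (F \<inter> G)" using inter[of F G] F G by simp
        ultimately have "j \<le> card (F \<inter> G - U \<inter> G)" by (simp add: j_def)
        then obtain J where "J \<subseteq> F \<inter> G - U \<inter> G" "card J = j"
          by (metis obtain_subset_with_card_n)
        then have "J \<in> \<J>" "F \<in> star (U \<union> J)" using F by (auto simp: \<J>_def)
        then show "F \<in> (\<Union>J\<in>\<J>. star (U \<union> J))" by blast
      qed
      have IH: "?c ^ (card U + j) * card (star (U \<union> J)) \<le> ?c ^ m * N m" if J: "J \<in> \<J>" for J
      proof -
        have finJ: "finite J" using J finG by (auto simp: \<J>_def intro: finite_subset)
        have "U \<inter> J = {}" "card J = j" using J by (auto simp: \<J>_def)
        then have cUJ: "card (U \<union> J) = card U + j"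
          using less.prems finJ by (simp add: card_Un_disjoint)
        have "m - card (U \<union> J) < m - card U" using cUJ False G(2) by (simp add: j_def)
        from less.hyps[OF this] show ?thesis using less.prems finJ unfolding cUJ by simp
      qed
      have "card (star U) \<le> (\<Sum>J\<in>\<J>. card (star (U \<union> J)))"
      proof -
        have "card (star U) \<le> card (\<Union>J\<in>\<J>. star (U \<union> J))"
          by (rule card_mono[OF finite_subset[OF _ finite_family] sub]) blast
        also have "\<dots> \<le> (\<Sum>J\<in>\<J>. card (star (U \<union> J)))" using fin\<J> by (rule card_UN_le)
        finally show ?thesis .
      qed
      then have "?c ^ (card U + j) * card (star U) \<le> (\<Sum>J\<in>\<J>. ?c ^ (card U + j) * card (star (U \<union> J)))"
        unfolding sum_distrib_left[symmetric] by (rule mult_le_mono2)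
      also have "\<dots> \<le> card \<J> * (?c ^ m * N m)"
        using IH sum_bounded_above[of \<J> "\<lambda>J. ?c ^ (card U + j) * card (star (U \<union> J))" "?c ^ m * N m"] by simp
      also have "\<dots> \<le> ?c ^ j * (?c ^ m * N m)" using c\<J> by (rule mult_le_mono1)
      finally have "?c ^ j * (?c ^ card U * card (star U)) \<le> ?c ^ j * (?c ^ m * N m)"
        by (simp only: power_add mult_ac)
      then show ?thesis by simp
    qed
  qed
qed

text \<open>A smallest signed cover may have any size \<open>m \<ge> t + 2\<close>. The weighted
  star bound applied to its \<open>t\<close>-subsets gives an estimate depending on
  \<open>m\<close>, and \<open>ratio\<close> shows that \<open>m = t + 2\<close> is the worst
  case.\<close>

lemma card_le_no_cover:
  assumes none: "covers = {}"
    and ratio: "\<And>q. t + 1 \<le> q \<Longrightarrow> (r - t + 1) * ((t + 1) * (t + 2)) * N (Suc q) \<le> 2 * N q"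
  shows "card \<F> \<le> ((t + 2) choose t) * ((r - t + 1) ^ 2 * N (t + 2))"
proof -
  let ?c = "r - t + 1"
  let ?P = "\<lambda>S. S \<in> signed_sets n (card S) k \<and> cover S"
  obtain F0 where F0: "F0 \<in> \<F>" using nonempty by blast
  \<comment> \<open>Every member is itself a signed cover, so a smallest one exists.\<close>
  have "?P F0" using mem[OF F0] inter[OF F0] by (simp add: cover_def)
  then obtain T where T: "?P T" "\<And>S. ?P S \<Longrightarrow> card T \<le> card S"
    using ex_has_least_nat[of ?P F0 card] by blast
  define m where "m = card T"
  have finT: "finite T" using T signed_setsD(4) by blast
  have "t \<le> m"
    using T(1) F0 card_mono[OF finT, of "T \<inter> F0"] unfolding cover_def m_def by force
  moreover have "m \<noteq> t + 1" using T(1) none by (auto simp: covers_def m_def)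
  moreover have "m \<noteq> t"
  proof
    assume "m = t"
    then have "T \<in> signed_sets n t k" using T(1) by (simp add: m_def)
    then obtain F where "F \<in> \<F>" "\<not> T \<subseteq> F" using not_all by blast
    then show False
      using T(1) card_not_subset_Int[OF finT, of F] \<open>m = t\<close> by (fastforce simp: cover_def m_def)
  qed
  ultimately have m: "t + 2 \<le> m" by simp
  have mono: "?c * N (Suc q) \<le> N q" if "m \<le> q" for q
  proof -
    have "2 * (?c * N (Suc q)) \<le> ((t + 1) * (t + 2)) * (?c * N (Suc q))"
      by (rule mult_le_mono1) (simp add: algebra_simps)
    also have "\<dots> \<le> 2 * N q" using ratio[of q] that m by (simp only: mult_ac)
    finally show ?thesis by simp
  qed
  have weighted: "?c ^ card U * card (star U) \<le> ?c ^ m * N m" if "finite U" for U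
    using T(2) mono that unfolding m_def by (intro star_weighted) auto
  let ?\<J> = "{J. J \<subseteq> T \<and> card J = t}"
  have fin\<J>: "finite ?\<J>" using finT by simp
  have sub: "\<F> \<subseteq> (\<Union>J\<in>?\<J>. star J)"
  proof
    fix F assume F: "F \<in> \<F>"
    then have "t \<le> card (T \<inter> F)" using T(1) by (simp add: cover_def)
    then obtain J where "J \<subseteq> T \<inter> F" "card J = t"
      by (metis obtain_subset_with_card_n)
    then show "F \<in> (\<Union>J\<in>?\<J>. star J)" using F by blast
  qed
  have "card \<F> \<le> card (\<Union>J\<in>?\<J>. star J)"
    by (rule card_mono[OF finite_subset[OF _ finite_family] sub]) blast
  also have "\<dots> \<le> (\<Sum>J\<in>?\<J>. card (star J))" using fin\<J> by (rule card_UN_le)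
  finally have "?c ^ t * card \<F> \<le> (\<Sum>J\<in>?\<J>. ?c ^ t * card (star J))"
    unfolding sum_distrib_left[symmetric] by (rule mult_le_mono2)
  also have "\<dots> \<le> card ?\<J> * (?c ^ m * N m)"
  proof -
    have "?c ^ t * card (star J) \<le> ?c ^ m * N m" if "J \<in> ?\<J>" for J
      using weighted[of J] that finT finite_subset by auto
    then show ?thesis
      using sum_bounded_above[of ?\<J> "\<lambda>J. ?c ^ t * card (star J)" "?c ^ m * N m"] by simp
  qed
  also have "card ?\<J> = m choose t" using n_subsets[OF finT] by (simp add: m_def)
  \<comment> \<open>Passing from \<open>q\<close> to \<open>q + 1\<close> multiplies the binomial by
    \<open>(q + 1) / (q + 1 - t)\<close>, while \<open>ratio\<close> makes
    \<open>?c * N (Suc q)\<close> at most \<open>2 / ((t + 1) * (t + 2))\<close> times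
    \<open>N q\<close>; for \<open>q \<ge> t + 2\<close> the product of the factors is at most
    1.\<close>
  also have "(m choose t) * (?c ^ m * N m) \<le> ((t + 2) choose t) * (?c ^ (t + 2) * N (t + 2))"
    using m
  proof (induction m rule: dec_induct)
    case (step q)
    have "((Suc q - t) * ((t + 1) * (t + 2))) * ((Suc q choose t) * (?c * N (Suc q)))
        = ((Suc q - t) * (Suc q choose t)) * (?c * ((t + 1) * (t + 2)) * N (Suc q))"
      by (simp only: mult_ac)
    also have "\<dots> = (Suc q * (q choose t)) * (?c * ((t + 1) * (t + 2)) * N (Suc q))"
      using binomial_absorb_comp[of "Suc q" t] by simp
    also have "\<dots> \<le> (Suc q * (q choose t)) * (2 * N q)"
      using ratio[of q] step.hyps by (intro mult_le_mono2) simp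
    also have "\<dots> = (2 * Suc q) * ((q choose t) * N q)" by (simp only: mult_ac)
    also have "\<dots> \<le> ((Suc q - t) * ((t + 1) * (t + 2))) * ((q choose t) * N q)"
    proof (rule mult_le_mono1)
      obtain i where i: "q = t + 2 + i" using step.hyps by (metis le_iff_add)
      show "2 * Suc q \<le> (Suc q - t) * ((t + 1) * (t + 2))" by (simp add: i algebra_simps)
    qed
    finally have "(Suc q choose t) * (?c * N (Suc q)) \<le> (q choose t) * N q"
      using step.hyps by (simp only: mult_le_cancel1) simp
    then have "?c ^ q * ((Suc q choose t) * (?c * N (Suc q))) \<le> ?c ^ q * ((q choose t) * N q)"
      by (rule mult_le_mono2)
    then have "(Suc q choose t) * (?c ^ Suc q * N (Suc q)) \<le> (q choose t) * (?c ^ q * N q)"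
      by (simp only: power_Suc mult_ac)
    then show ?case using step.IH by (rule order_trans)
  qed simp
  finally have "?c ^ t * card \<F> \<le> ?c ^ t * (((t + 2) choose t) * (?c ^ 2 * N (t + 2)))"
    by (simp only: power_add mult_ac)
  then show ?thesis by simp
qed

end

section \<open>Covers without a common \<open>t\<close>-subset\<close>

text \<open>Two subsets of size at least \<open>t + 1\<close> in a set of size \<open>t + 2\<close>
  share at least \<open>2 * (t + 1) - (t + 2) = t\<close> points.\<close>

lemma t_intersecting_near_full:
  assumes "finite X" "card X = t + 2"
  shows "t_intersecting t {F \<in> signed_sets n r k. t + 1 \<le> card (F \<inter> X)}"
  unfolding t_intersecting_def
proof (intro ballI, clarify)
  fix F G assume *: "F \<in> signed_sets n r k" "t + 1 \<le> card (F \<inter> X)" "t + 1 \<le> card (G \<inter> X)"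
  have "t \<le> card (F \<inter> G \<inter> X)" using card_Int_lower[OF assms(1), of F G] * assms(2) by simp
  also have "\<dots> \<le> card (F \<inter> G)" using signed_setsD(4)[OF *(1)] by (intro card_mono) auto
  finally show "t \<le> card (F \<inter> G)" .
qed

lemma card_near_full_le:
  assumes "finite X" "card X = t + 2"
  shows "card {F \<in> signed_sets n r k. t + 1 \<le> card (F \<inter> X)} \<le> (t + 2) * star_size n r k (t + 1)"
proof -
  let ?\<T> = "{T. T \<subseteq> X \<and> card T = t + 1}"
  have "card {F \<in> signed_sets n r k. t + 1 \<le> card (F \<inter> X)} \<le> card ?\<T> * star_size n r k (t + 1)"
  proof (rule card_le_card_times)
    show "{F \<in> signed_sets n r k. t + 1 \<le> card (F \<inter> X)} \<subseteq> (\<Union>T\<in>?\<T>. {F \<in> signed_sets n r k. T \<subseteq> F})"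
    proof clarify
      fix F assume F: "F \<in> signed_sets n r k" "t + 1 \<le> card (F \<inter> X)"
      then obtain T where "T \<subseteq> F \<inter> X" "card T = t + 1" by (metis obtain_subset_with_card_n)
      then show "F \<in> (\<Union>T\<in>?\<T>. {F \<in> signed_sets n r k. T \<subseteq> F})" using F(1) by blast
    qed
    show "card {F \<in> signed_sets n r k. T \<subseteq> F} \<le> star_size n r k (t + 1)" if "T \<in> ?\<T>" for T
      using that card_star_le[of "signed_sets n r k" n r k T] by simp
  qed (use assms(1) finite_signed_sets in auto)
  moreover have "card ?\<T> = t + 2"
    using n_subsets[OF assms(1), of "t + 1"] assms(2) by simp
  ultimately show ?thesis by simp
qed

context maximal_nontrivial_family
begin

text \<open>For \<open>e\<close> in \<open>A\<close> and \<open>B\<close> but not in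
  \<open>C\<close>, the \<open>t\<close> other points of \<open>A\<close>, and likewise of
  \<open>B\<close>, must lie in \<open>C\<close>; so \<open>C\<close> is \<open>A \<union> B\<close>
  without \<open>e\<close>. A member meeting \<open>A \<union> B\<close> in at most \<open>t\<close>
  points would have this intersection inside all three covers. Each of them omits a different point,
  leaving only \<open>t - 1\<close>.\<close>

lemma triangle_structure:
  assumes A: "A \<in> covers" and B: "B \<in> covers" and C: "C \<in> covers" and "A \<noteq> B" "\<not> A \<inter> B \<subseteq> C"
  obtains X where "X \<in> signed_sets n (t + 2) k" "\<F> = {F \<in> signed_sets n r k. t + 1 \<le> card (F \<inter> X)}"
proof -
  note A' = coversD[OF A] and B' = coversD[OF B] and C' = coversD[OF C]
  have "card (A \<inter> B) < t + 1"
  proof -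
    have "\<not> A \<subseteq> B" using assms(4) A' B' card_subset_eq by metis
    then show ?thesis using card_not_subset_Int[OF A'(4)] A'(3) by simp
  qed
  then have AB: "card (A \<inter> B) = t" using covers_inter[OF A B] by simp
  then have "card (A - B) = 1" "card (B - A) = 1"
    using A' B' by (simp_all add: card_Diff_subset_Int Int_commute)
  then obtain a b where a: "A - B = {a}" and b: "B - A = {b}" by (metis card_1_singletonE)
  obtain e where e: "e \<in> A" "e \<in> B" "e \<notin> C" using assms(5) by blast
  define X where "X = A \<union> B"
  have finX: "finite X" using A'(4) B'(4) by (simp add: X_def)
  have cX: "card X = t + 2"
    using card_Un_Int[OF A'(4) B'(4)] A'(3) B'(3) AB by (simp add: X_def)
  have sub: "S - {e} \<subseteq> C" if "S \<in> covers" "e \<in> S" for S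
  proof -
    note S = coversD[OF that(1)]
    have "S \<inter> C \<subseteq> S - {e}" using e(3) by blast
    moreover have "card (S - {e}) = t" using S that(2) by simp
    ultimately have "S \<inter> C = S - {e}"
      using covers_inter[OF that(1) C] S(4) by (intro card_seteq) auto
    then show ?thesis by blast
  qed
  have XC: "X - {e} \<subseteq> C" using sub[OF A e(1)] sub[OF B e(2)] by (auto simp: X_def)
  have XA: "X - {b} \<subseteq> A" and XB: "X - {a} \<subseteq> B" using a b by (auto simp: X_def)
  have ne: "a \<noteq> b" "a \<noteq> e" "b \<noteq> e" using a b e by auto
  have inX: "a \<in> X" "b \<in> X" "e \<in> X" using a b e by (auto simp: X_def)
  have "inj_on fst X"
  proof (rule inj_onI)
    fix x y assume xy: "x \<in> X" "y \<in> X" "fst x = fst y"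
    \<comment> \<open>The three covers omit different points of \<open>X\<close>, so any two points
      of \<open>X\<close> share one of these signed sets.\<close>
    have "(x \<in> A \<and> y \<in> A) \<or> (x \<in> B \<and> y \<in> B) \<or> (x \<in> C \<and> y \<in> C)" using xy XA XB XC ne by blast
    then show "x = y"
      using xy(3) signed_setsD(2)[OF A'(1)] signed_setsD(2)[OF B'(1)] signed_setsD(2)[OF C'(1)]
      by (auto dest: inj_onD)
  qed
  moreover have "X \<subseteq> {1..n} \<times> {1..k}"
    using signed_setsD(1)[OF A'(1)] signed_setsD(1)[OF B'(1)] by (simp add: X_def)
  ultimately have X: "X \<in> signed_sets n (t + 2) k" using cX by (intro signed_setsI)
  have ge: "t + 1 \<le> card (F \<inter> X)" if F: "F \<in> \<F>" for F
  proof (rule ccontr)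
    assume "\<not> t + 1 \<le> card (F \<inter> X)"
    then have le: "card (F \<inter> X) \<le> t" by simp
    have *: "F \<inter> X \<subseteq> S" if "S \<in> covers" "S \<subseteq> X" for S
    proof -
      have "t \<le> card (S \<inter> F)" using coversD(2)[OF that(1)] F by (simp add: cover_def)
      then have "S \<inter> F = F \<inter> X" using le that(2) finX by (intro card_seteq) auto
      then show ?thesis by blast
    qed
    have "C \<subseteq> X"
    proof -
      have "card (X - {e}) = t + 1" using cX inX finX by simp
      then have "X - {e} = C" using XC C' by (intro card_subset_eq) auto
      then show ?thesis by blast
    qed
    then have "F \<inter> X \<subseteq> X - {a, b, e}"
      using *[OF A] *[OF B] *[OF C] a b e by (auto simp: X_def)
    then have "card (F \<inter> X) \<le> card (X - {a, b, e})" using finX by (intro card_mono) auto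
    also have "\<dots> = t - 1" using inX ne finX cX by (simp add: card_Diff_subset)
    finally have "card (F \<inter> X) \<le> t - 1" .
    moreover have "t \<le> card (A \<inter> F)" using A'(2) F by (simp add: cover_def)
    moreover have "card (A \<inter> F) \<le> card (F \<inter> X)" using finX by (intro card_mono) (auto simp: X_def)
    ultimately show False using t by simp
  qed
  have "\<F> = {F \<in> signed_sets n r k. t + 1 \<le> card (F \<inter> X)}"
    using ge subset_signed t_intersecting_near_full[OF finX cX]
    by (intro maximal_eq) auto
  then show ?thesis using that X by blast
qed

text \<open>Two distinct covers share exactly \<open>t\<close> points, so their intersection is the
  only candidate for \<open>E\<close>; a cover not containing it yields the triangle.\<close>

lemma common_subset_or_triangle:
  assumes "covers \<noteq> {}"
  obtains E where "card E = t" "\<forall>T\<in>covers. E \<subseteq> T"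
  | A B C where "A \<in> covers" "B \<in> covers" "C \<in> covers" "A \<noteq> B" "\<not> A \<inter> B \<subseteq> C"
proof -
  obtain A where A: "A \<in> covers" using assms by blast
  show ?thesis
  proof (cases "\<exists>B\<in>covers. A \<noteq> B")
    case False
    obtain E where "E \<subseteq> A" "card E = t"
      using coversD(3)[OF A] obtain_subset_with_card_n[of t A] by auto
    then show ?thesis using False that(1) by blast
  next
    case True
    then obtain B where B: "B \<in> covers" "A \<noteq> B" by blast
    have "\<not> A \<subseteq> B" using B coversD[OF A] coversD[OF B(1)] card_subset_eq by metis
    then have "card (A \<inter> B) = t"
      using card_not_subset_Int[OF coversD(4)[OF A], of B] covers_inter[OF A B(1)] coversD(3)[OF A] by simp
    then show ?thesis using that A B by blast
  qed
qed

end

section \<open>Covers with a common \<open>t\<close>-subset\<close>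

text \<open>If one of two members lacks \<open>E\<close>, it meets \<open>X\<close> in all but one
  point, and the other meets \<open>X\<close> in at least \<open>t + 1\<close> points.\<close>

lemma t_intersecting_H1_on:
  assumes "finite X" "t + 2 \<le> card X" "card E = t" "finite E"
  shows "t_intersecting t (H1_on n r k t E X)"
  unfolding t_intersecting_def
proof (intro ballI)
  fix F G assume F: "F \<in> H1_on n r k t E X" and G: "G \<in> H1_on n r k t E X"
  have fin: "finite F" using F signed_setsD(4) by (auto simp: H1_on_def)
  show "t \<le> card (F \<inter> G)"
  proof (cases "E \<subseteq> F \<and> E \<subseteq> G")
    case True
    then show ?thesis using card_mono[of "F \<inter> G" E] fin assms(3) by simp
  next
    case False
    then have "t + card X \<le> card (F \<inter> X) + card (G \<inter> X)"
      using F G assms(2) by (auto simp: H1_on_def)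
    then have "t \<le> card (F \<inter> G \<inter> X)" using card_Int_lower[OF assms(1), of F G] by simp
    also have "\<dots> \<le> card (F \<inter> G)" using fin by (intro card_mono) auto
    finally show ?thesis .
  qed
qed

lemma t_intersecting_H2_on:
  assumes "finite X" "t + 2 \<le> r" "card X = r" "card E = t" "E \<subseteq> X" "X \<inter> Y = {}" "finite Y"
  shows "t_intersecting t (H2_on n r k t E X Y)"
proof -
  let ?A = "\<lambda>F. E \<subseteq> F \<and> t + 1 \<le> card (F \<inter> X)"
  let ?B = "\<lambda>F. F \<inter> X = E \<and> Y \<subseteq> F"
  let ?C = "\<lambda>F. \<not> E \<subseteq> F \<and> card (F \<inter> X) = r - 1 \<and> card (F \<inter> Y) = 1"
  \<comment> \<open>The delicate pair is a member with \<open>F \<inter> X = E\<close> against one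
    lacking a point of \<open>E\<close>: they share \<open>t - 1\<close> points of \<open>E\<close>,
    and \<open>Y\<close> supplies the last one.\<close>
  have C: "t \<le> card (F \<inter> G)" if F: "?A F \<or> ?B F \<or> ?C F" and G: "?C G" and fin: "finite F" for F G
  proof (cases "?B F")
    case True
    have "E \<inter> X = E" "E \<inter> G \<inter> X = E \<inter> G" using assms(5) by auto
    then have "t + (r - 1) \<le> card (E \<inter> G) + r"
      using card_Int_lower[OF assms(1), of E G] G assms(3,4) by simp
    moreover have "card (E \<inter> G) + card (G \<inter> Y) = card (E \<inter> G \<union> G \<inter> Y)"
      using assms finite_subset[OF assms(5,1)] by (intro card_Un_disjoint[symmetric]) auto
    moreover have "card (E \<inter> G \<union> G \<inter> Y) \<le> card (F \<inter> G)"
      using True fin by (intro card_mono) auto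
    ultimately show ?thesis using G assms(2) by linarith
  next
    case False
    then have "t + 1 \<le> card (F \<inter> X)" using F assms(2) by (elim disjE conjE) simp_all
    then have "t \<le> card (F \<inter> G \<inter> X)"
      using card_Int_lower[OF assms(1), of F G] G assms(2,3) by linarith
    also have "\<dots> \<le> card (F \<inter> G)" using fin by (intro card_mono) auto
    finally show ?thesis .
  qed
  show ?thesis
    unfolding t_intersecting_def
  proof (intro ballI)
    fix F G assume F: "F \<in> H2_on n r k t E X Y" and G: "G \<in> H2_on n r k t E X Y"
    have fin: "finite F" "finite G" using F G signed_setsD(4) by (auto simp: H2_on_def)
    have F': "?A F \<or> ?B F \<or> ?C F" and G': "?A G \<or> ?B G \<or> ?C G"
      using F G unfolding H2_on_def by blast+
    consider "E \<subseteq> F" "E \<subseteq> G" | "?C F" | "?C G" using F' G' by blast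
    then show "t \<le> card (F \<inter> G)"
    proof cases
      case 1
      then show ?thesis using card_mono[of "F \<inter> G" E] fin assms(4) by simp
    next
      case 2
      then show ?thesis using C[OF G' 2 fin(2)] by (simp only: Int_commute)
    next
      case 3
      then show ?thesis using C[OF F' 3 fin(1)] by simp
    qed
  qed
qed

text \<open>The covers of size \<open>t + 1\<close> form a sunflower with kernel \<open>E\<close>
  and one-point petals. If there is only one cover, any of its \<open>t\<close>-subsets can serve as
  \<open>E\<close>.\<close>

locale sunflower_covers = maximal_nontrivial_family +
  fixes E :: "(nat \<times> nat) set"
  assumes covers_nonempty: "covers \<noteq> {}" and cardE: "card E = t" and common: "\<forall>T\<in>covers. E \<subseteq> T"
begin

definition D :: "(nat \<times> nat) set" where
  "D = {x. x \<notin> E \<and> insert x E \<in> covers}"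

abbreviation X :: "(nat \<times> nat) set" where
  "X \<equiv> E \<union> D"

lemma finiteE: "finite E"
  using cardE t by (metis card.infinite not_one_le_zero)

lemma covers_eq: "covers = (\<lambda>x. insert x E) ` D"
proof
  show "covers \<subseteq> (\<lambda>x. insert x E) ` D"
  proof
    fix T assume T: "T \<in> covers"
    then have "E \<subseteq> T" using common by blast
    moreover from this have "card (T - E) = 1"
      using coversD[OF T] cardE finiteE by (simp add: card_Diff_subset)
    then obtain x where "T - E = {x}" by (rule card_1_singletonE)
    ultimately have "T = insert x E" "x \<notin> E" by auto
    then show "T \<in> (\<lambda>x. insert x E) ` D" using T by (auto simp: D_def)
  qed
qed (auto simp: D_def)

lemma D_nonempty: "D \<noteq> {}"
  using covers_nonempty covers_eq by auto

lemma D_disjoint: "E \<inter> D = {}"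
  by (auto simp: D_def)

lemma D_cover: "x \<in> D \<Longrightarrow> F \<in> \<F> \<Longrightarrow> t \<le> card (insert x E \<inter> F)"
  using coversD(2)[of "insert x E"] by (auto simp: D_def cover_def)

lemma signedE: "E \<in> signed_sets n t k"
proof -
  obtain x where "x \<in> D" using D_nonempty by blast
  then have "insert x E \<in> signed_sets n (t + 1) k" using coversD(1) by (auto simp: D_def)
  then have "E \<in> signed_sets n (card E) k" by (rule signed_sets_subset) blast
  then show ?thesis by (simp add: cardE)
qed

text \<open>A cover \<open>insert x E\<close> can afford to lose only one point in \<open>F\<close>.
  A point of \<open>E\<close> is already lost, so it is the only one and \<open>x\<close> is
  present.\<close>

lemma missing:
  assumes "F \<in> \<F>" "\<not> E \<subseteq> F"
  shows "card (E \<inter> F) = t - 1" "D \<subseteq> F"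
proof -
  have lt: "card (E \<inter> F) < t" using card_not_subset_Int[OF finiteE assms(2)] cardE by simp
  have *: "x \<in> F \<and> card (E \<inter> F) = t - 1" if "x \<in> D" for x
  proof (cases "x \<in> F")
    case True
    then have "t \<le> Suc (card (E \<inter> F))"
      using D_cover[OF that assms(1)] card_insert_le_m1 finiteE
      by (simp add: Int_insert_left card_insert_if split: if_splits)
    then show ?thesis using lt True by simp
  next
    case False
    then show ?thesis using D_cover[OF that assms(1)] lt by (simp add: Int_insert_left)
  qed
  then show "card (E \<inter> F) = t - 1" using D_nonempty by blast
  show "D \<subseteq> F" using * by blast
qed

definition F0 :: "(nat \<times> nat) set" where
  "F0 = (SOME F. F \<in> \<F> \<and> \<not> E \<subseteq> F)"

lemma F0: "F0 \<in> \<F>" "\<not> E \<subseteq> F0"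
  using someI_ex[of "\<lambda>F. F \<in> \<F> \<and> \<not> E \<subseteq> F"] not_all[OF signedE] by (auto simp: F0_def)

lemma finiteD: "finite D"
  using missing(2)[OF F0] mem(3)[OF F0(1)] by (rule finite_subset)

lemma cardX: "card X = t + card D"
  using finiteE finiteD D_disjoint cardE by (simp add: card_Un_disjoint)

lemma card_missing_Int:
  assumes "F \<in> \<F>" "\<not> E \<subseteq> F"
  shows "card (F \<inter> X) = t - 1 + card D"
proof -
  have "F \<inter> X = (E \<inter> F) \<union> D" using missing(2)[OF assms] by blast
  moreover have "card ((E \<inter> F) \<union> D) = card (E \<inter> F) + card D"
    using finiteE finiteD D_disjoint by (intro card_Un_disjoint) auto
  ultimately show ?thesis using missing(1)[OF assms] by simp
qed

text \<open>Such a member spends \<open>t - 1\<close> points on \<open>E\<close> and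
  \<open>card D\<close> on \<open>D\<close>; what remains of \<open>r\<close> lies outside
  \<open>X\<close>.\<close>

lemma card_missing_Diff:
  assumes "F \<in> \<F>" "\<not> E \<subseteq> F"
  shows "card (F - X) + card D = r - t + 1"
proof -
  have "card (F \<inter> X) + card (F - X) = r"
    using mem[OF assms(1)] card_Int_Diff[of F X] by simp
  then show ?thesis using card_missing_Int[OF assms] t tr by linarith
qed

lemma cardD_le: "card D \<le> r - t + 1"
  using card_missing_Diff[OF F0] by simp

text \<open>For \<open>r = t + 1\<close> the members are themselves covers of size
  \<open>t + 1\<close>, so all of them would contain \<open>E\<close>.\<close>

lemma r_ge: "t + 2 \<le> r"
proof (rule ccontr)
  assume "\<not> t + 2 \<le> r"
  then have r: "r = t + 1" using tr by simp
  have "F0 \<in> covers"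
    using mem[OF F0(1)] inter[OF F0(1)] r by (simp add: covers_def cover_def)
  then show False using common F0(2) by blast
qed

lemma signedX: "X \<in> signed_sets n (t + card D) k"
proof (rule signed_setsI)
  have ins: "insert x E \<in> signed_sets n (t + 1) k" if "x \<in> D" for x
    using that coversD(1) by (auto simp: D_def)
  show "X \<subseteq> {1..n} \<times> {1..k}"
    using signed_setsD(1)[OF signedE] signed_setsD(1)[OF mem(1)[OF F0(1)]] missing(2)[OF F0] by blast
  show "inj_on fst X"
  proof (rule inj_onI)
    fix x y assume xy: "x \<in> X" "y \<in> X" "fst x = fst y"
    \<comment> \<open>Two points of \<open>D\<close> lie together in \<open>F0\<close>; any other
      pair lies in a cover \<open>insert z E\<close>.\<close>
    obtain S q where "S \<in> signed_sets n q k" "x \<in> S" "y \<in> S"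
    proof (cases "x \<in> D \<and> y \<in> D")
      case True
      then show ?thesis using that mem(1)[OF F0(1)] missing(2)[OF F0] by blast
    next
      case False
      then obtain z where "z \<in> D" "x \<in> insert z E" "y \<in> insert z E" using xy D_nonempty by blast
      then show ?thesis using that ins by blast
    qed
    then show "x = y" using inj_onD[OF signed_setsD(2)] xy(3) by blast
  qed
qed (rule cardX)

text \<open>The third hypothesis keeps \<open>S\<close> out of \<open>covers\<close>, so some member
  meets it in fewer than \<open>t\<close> points. Since \<open>S\<close> shares \<open>t\<close>
  points with a cover, the deficit is exactly one and a single branching reaches size
  \<open>t + 2\<close>.\<close>

lemma card_noncover:
  assumes "finite S" "card S = t + 1" "\<not> E \<subseteq> S \<or> S - E \<noteq> {} \<and> S \<inter> D = {}" "x \<in> D"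
    and "t \<le> card (S \<inter> insert x E)"
  shows "card (star S) \<le> (r - t + 1) * N (t + 2)"
proof (cases "star S = {}")
  case True
  then have "card (star S) = 0" by (simp only: card.empty)
  then show ?thesis by (simp only: le0)
next
  case False
  then obtain F where "F \<in> \<F>" "S \<subseteq> F" by blast
  then have S: "S \<in> signed_sets n (t + 1) k" using signed_sets_subset[OF mem(1)] assms(2) by metis
  have "S \<notin> covers" using assms(3) unfolding covers_eq by blast
  then obtain G where G: "G \<in> \<F>" "card (S \<inter> G) < t" using S by (auto simp: covers_def cover_def not_le)
  have cT: "card (insert x E) = t + 1" using assms(4) cardE finiteE by (simp add: D_def)
  have "t + t \<le> card (S \<inter> insert x E) + card (G \<inter> insert x E)"
    using D_cover[OF assms(4) G(1)] assms(5) by (simp add: Int_commute add_mono)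
  also have "\<dots> \<le> card (S \<inter> G \<inter> insert x E) + (t + 1)"
    using card_Int_lower[of "insert x E" S G] finiteE cT by simp
  also have "card (S \<inter> G \<inter> insert x E) \<le> card (S \<inter> G)" using assms(1) by (intro card_mono) auto
  finally have "t \<le> card (S \<inter> G) + 1" by simp
  from card_star_step[OF assms(1) G this] show ?thesis using assms(2) by simp
qed

lemma card_meeting_D: "card {F \<in> \<F>. E \<subseteq> F \<and> F \<inter> D \<noteq> {}} \<le> card D * N (t + 1)"
proof (rule card_le_card_times[OF finiteD])
  show "{F \<in> \<F>. E \<subseteq> F \<and> F \<inter> D \<noteq> {}} \<subseteq> (\<Union>x\<in>D. star (insert x E))" by blast
  show "card (star (insert x E)) \<le> N (t + 1)" if "x \<in> D" for x
    using card_star_bound[of "insert x E"] that cardE finiteE by (simp add: D_def)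
qed (use finite_family in simp)

text \<open>\<open>F\<close> offers only \<open>t - 1\<close> points of \<open>E\<close>, and
  \<open>G\<close> avoids \<open>D\<close>; a further common point must lie outside
  \<open>X\<close>.\<close>

lemma avoiding_D_meets:
  assumes "G \<in> \<F>" "E \<subseteq> G" "G \<inter> D = {}" "F \<in> \<F>" "\<not> E \<subseteq> F"
  shows "G \<inter> (F - X) \<noteq> {}"
proof
  assume "G \<inter> (F - X) = {}"
  then have "G \<inter> F \<subseteq> E \<inter> F" using assms(3) by blast
  then have "card (G \<inter> F) \<le> card (E \<inter> F)" using finiteE by (intro card_mono) auto
  then show False using inter[OF assms(1,4)] missing(1)[OF assms(4,5)] t by simp
qed

text \<open>One branching over the few points of \<open>F0 - X\<close>, then one more because
  \<open>insert z E\<close> is not a cover.\<close>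

lemma card_avoiding_D:
  "card {F \<in> \<F>. E \<subseteq> F \<and> F \<inter> D = {}} \<le> (r - t + 1 - card D) * ((r - t + 1) * N (t + 2))"
proof -
  have "card {F \<in> \<F>. E \<subseteq> F \<and> F \<inter> D = {}} \<le> card (F0 - X) * ((r - t + 1) * N (t + 2))"
  proof (rule card_le_card_times)
    show "{F \<in> \<F>. E \<subseteq> F \<and> F \<inter> D = {}} \<subseteq> (\<Union>z\<in>F0 - X. star (insert z E))"
    proof (rule subsetI)
      fix F assume "F \<in> {F \<in> \<F>. E \<subseteq> F \<and> F \<inter> D = {}}"
      then have F: "F \<in> \<F>" "E \<subseteq> F" "F \<inter> D = {}" by simp_all
      obtain z where "z \<in> F" "z \<in> F0 - X" using avoiding_D_meets[OF F F0] by (meson IntE ex_in_conv)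
      then show "F \<in> (\<Union>z\<in>F0 - X. star (insert z E))" using F(1,2) by (intro UN_I[of z]) simp_all
    qed
    fix z assume z: "z \<in> F0 - X"
    obtain x where x: "x \<in> D" using D_nonempty by blast
    have "card E \<le> card (insert z E \<inter> insert x E)" using finiteE by (intro card_mono) auto
    then show "card (star (insert z E)) \<le> (r - t + 1) * N (t + 2)"
      using z x finiteE cardE D_disjoint by (intro card_noncover[of _ x]) auto
  qed (use finite_family mem(3)[OF F0(1)] in auto)
  moreover have "card (F0 - X) = r - t + 1 - card D" using card_missing_Diff[OF F0] by linarith
  ultimately show ?thesis by (simp only:)
qed

lemma missing_contains:
  assumes "F \<in> \<F>" "\<not> E \<subseteq> F"
  obtains e where "e \<in> E" "e \<notin> F" "E - {e} \<union> D \<subseteq> F"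
proof -
  obtain e where e: "e \<in> E" "e \<notin> F" using assms(2) by blast
  have "E \<inter> F = E - {e}"
    using missing(1)[OF assms] finiteE e cardE by (intro card_subset_eq) auto
  then show ?thesis using that e missing(2)[OF assms] by blast
qed

text \<open>With \<open>e\<close> the missing point of \<open>E\<close>, such a member contains only
  the \<open>t\<close>-set \<open>insert x (E - {e})\<close> for sure. Non-triviality provides a
  \<open>G\<close> not containing this set, and two branchings are needed.\<close>

lemma card_missing_1:
  assumes "card D = 1"
  shows "card {F \<in> \<F>. \<not> E \<subseteq> F} \<le> t * ((r - t) * ((r - t + 1) * N (t + 2)))"
proof -
  obtain x where D: "D = {x}" using assms by (rule card_1_singletonE)
  have x: "x \<in> D" "x \<notin> E" using D D_disjoint by auto
  have "card {F \<in> \<F>. \<not> E \<subseteq> F} \<le> card E * ((r - t) * ((r - t + 1) * N (t + 2)))"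
  proof (rule card_le_card_times[OF finiteE])
    show "{F \<in> \<F>. \<not> E \<subseteq> F} \<subseteq> (\<Union>e\<in>E. {F \<in> \<F>. e \<notin> F \<and> insert x (E - {e}) \<subseteq> F})"
    proof (rule subsetI)
      fix F assume "F \<in> {F \<in> \<F>. \<not> E \<subseteq> F}"
      then have F: "F \<in> \<F>" "\<not> E \<subseteq> F" by simp_all
      obtain e where "e \<in> E" "e \<notin> F" "E - {e} \<union> D \<subseteq> F" using F by (rule missing_contains)
      moreover from this have "insert x (E - {e}) \<subseteq> F" using D by simp
      ultimately show "F \<in> (\<Union>e\<in>E. {F \<in> \<F>. e \<notin> F \<and> insert x (E - {e}) \<subseteq> F})" using F(1) by (intro UN_I[of e]) simp_all
    qed
    fix e assume e: "e \<in> E"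
    let ?W = "insert x (E - {e})"
    have W: "card ?W = t" "finite ?W" using e x cardE finiteE t by simp_all
    have cxE: "card (insert x E) = t + 1" using x cardE finiteE by simp
    have "insert x E \<in> signed_sets n (t + 1) k" using x(1) coversD(1) by (auto simp: D_def)
    then have "?W \<in> signed_sets n (card ?W) k" by (rule signed_sets_subset) blast
    then obtain G where G: "G \<in> \<F>" "\<not> ?W \<subseteq> G" using not_all W(1) by auto
    have lt: "card (?W \<inter> G) < t" using card_not_subset_Int[OF W(2) G(2)] W(1) by simp
    have "e \<in> G" "t \<le> card (?W \<inter> G) + 1"
    proof -
      have eq: "insert x E \<inter> G = (?W \<inter> G) \<union> ({e} \<inter> G)" using e by blast
      have "t \<le> card (?W \<inter> G) + card ({e} \<inter> G)"
        using D_cover[OF x(1) G(1)] card_Un_le[of "?W \<inter> G" "{e} \<inter> G"] unfolding eq by linarith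
      moreover from this show "e \<in> G" using lt by (cases "e \<in> G") simp_all
      ultimately show "t \<le> card (?W \<inter> G) + 1" by simp
    qed
    \<comment> \<open>Since \<open>insert x E\<close> is a cover, \<open>G\<close> contains
      \<open>e\<close>. The members counted omit \<open>e\<close>, so the first branching has
      \<open>r - t\<close> choices instead of \<open>r - t + 1\<close>.\<close>
    have cG: "card (G - insert e ?W) = r - t"
    proof -
      have ie: "insert e ?W = insert x E" using e by blast
      have "e \<notin> ?W \<inter> G" using e x by auto
      have "G \<inter> insert e ?W = insert e (?W \<inter> G)" using \<open>e \<in> G\<close> by blast
      then have "card (G \<inter> insert e ?W) = card (insert e (?W \<inter> G))" by (simp only:)
      also have "\<dots> = t" using \<open>e \<notin> ?W \<inter> G\<close> lt \<open>t \<le> card (?W \<inter> G) + 1\<close> W(2) by simp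
      finally show ?thesis using mem(2,3)[OF G(1)] by (simp add: card_Diff_subset_Int)
    qed
    have "card {F \<in> \<F>. e \<notin> F \<and> ?W \<subseteq> F} \<le> card (G - insert e ?W) * ((r - t + 1) * N (t + 2))"
    proof (rule card_le_card_times)
      show "{F \<in> \<F>. e \<notin> F \<and> ?W \<subseteq> F} \<subseteq> (\<Union>z\<in>G - insert e ?W. star (insert z ?W))"
      proof clarify
        fix F assume F: "F \<in> \<F>" "e \<notin> F" "?W \<subseteq> F"
        have "\<not> F \<inter> G \<subseteq> ?W \<inter> G"
          using inter[OF F(1) G(1)] lt card_mono[of "?W \<inter> G" "F \<inter> G"] W(2) by auto
        then show "F \<in> (\<Union>z\<in>G - insert e ?W. star (insert z ?W))" using F by blast
      qed
      fix z assume z: "z \<in> G - insert e ?W"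
      have "card ?W \<le> card (insert z ?W \<inter> insert x E)" using finiteE by (intro card_mono) auto
      then show "card (star (insert z ?W)) \<le> (r - t + 1) * N (t + 2)"
        using z x W e by (intro card_noncover[of _ x]) auto
    qed (use finite_family mem(3)[OF G(1)] in auto)
    then show "card {F \<in> \<F>. e \<notin> F \<and> ?W \<subseteq> F} \<le> (r - t) * ((r - t + 1) * N (t + 2))"
      unfolding cG .
  qed (use finite_family in simp)
  then show ?thesis unfolding cardE .
qed

lemma missing_subset_UN: "{F \<in> \<F>. \<not> E \<subseteq> F} \<subseteq> (\<Union>e\<in>E. star (E - {e} \<union> D))"
proof (rule subsetI)
  fix F assume "F \<in> {F \<in> \<F>. \<not> E \<subseteq> F}"
  then have F: "F \<in> \<F>" "\<not> E \<subseteq> F" by simp_all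
  obtain e where "e \<in> E" "e \<notin> F" "E - {e} \<union> D \<subseteq> F" using F by (rule missing_contains)
  then show "F \<in> (\<Union>e\<in>E. star (E - {e} \<union> D))" using F(1) by (intro UN_I[of e]) simp_all
qed

text \<open>Here \<open>E - {e} \<union> D\<close> has \<open>t + 1\<close> points and is not a
  cover since it lacks \<open>e\<close>; one branching suffices.\<close>

lemma card_missing_2:
  assumes "card D = 2"
  shows "card {F \<in> \<F>. \<not> E \<subseteq> F} \<le> t * ((r - t + 1) * N (t + 2))"
proof -
  have "card {F \<in> \<F>. \<not> E \<subseteq> F} \<le> card E * ((r - t + 1) * N (t + 2))"
  proof (rule card_le_card_times[OF finiteE missing_subset_UN])
    fix e assume e: "e \<in> E"
    obtain x where x: "x \<in> D" using D_nonempty by blast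
    have "card (E - {e} \<union> D) = card (E - {e}) + card D"
      using finiteE finiteD D_disjoint by (intro card_Un_disjoint) auto
    then have c: "card (E - {e} \<union> D) = t + 1" using e cardE finiteE t assms by simp
    have "x \<notin> E" using x D_disjoint by blast
    then have "card (insert x (E - {e})) = t" using e cardE finiteE t by simp
    moreover have "card (insert x (E - {e})) \<le> card ((E - {e} \<union> D) \<inter> insert x E)"
      using finiteE x by (intro card_mono) auto
    ultimately have "t \<le> card ((E - {e} \<union> D) \<inter> insert x E)" by simp
    moreover have "\<not> E \<subseteq> E - {e} \<union> D" using e D_disjoint by blast
    ultimately show "card (star (E - {e} \<union> D)) \<le> (r - t + 1) * N (t + 2)"
      using x c finiteE finiteD by (intro card_noncover[of _ x]) auto
  qed (use finite_family in simp)
  then show ?thesis unfolding cardE .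
qed

lemma card_missing_3:
  assumes "3 \<le> card D"
  shows "card {F \<in> \<F>. \<not> E \<subseteq> F} \<le> t * N (t + 2)"
proof -
  obtain D' where D': "D' \<subseteq> D" "card D' = 3" "finite D'"
    using obtain_subset_with_card_n[OF assms] by blast
  have "card {F \<in> \<F>. \<not> E \<subseteq> F} \<le> card E * N (t + 2)"
  proof (rule card_le_card_times[OF finiteE missing_subset_UN])
    fix e assume e: "e \<in> E"
    have "card (E - {e} \<union> D') = card (E - {e}) + card D'"
      using finiteE D' D_disjoint by (intro card_Un_disjoint) auto
    then have "card (E - {e} \<union> D') = t + 2" using e cardE finiteE t D' by simp
    then have "card (star (E - {e} \<union> D')) \<le> N (t + 2)" using card_star_bound[of "E - {e} \<union> D'"] by simp
    moreover have "card (star (E - {e} \<union> D)) \<le> card (star (E - {e} \<union> D'))"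
      using D'(1) finite_family by (intro card_mono) auto
    ultimately show "card (star (E - {e} \<union> D)) \<le> N (t + 2)" by simp
  qed (use finite_family in simp)
  then show ?thesis unfolding cardE .
qed

lemma card_split:
  "card \<F> = card {F \<in> \<F>. E \<subseteq> F \<and> F \<inter> D \<noteq> {}} + card {F \<in> \<F>. E \<subseteq> F \<and> F \<inter> D = {}}
    + card {F \<in> \<F>. \<not> E \<subseteq> F}"
proof -
  have "card \<F> = card (({F \<in> \<F>. E \<subseteq> F \<and> F \<inter> D \<noteq> {}} \<union> {F \<in> \<F>. E \<subseteq> F \<and> F \<inter> D = {}}) \<union> {F \<in> \<F>. \<not> E \<subseteq> F})"
    by (rule arg_cong[where f = card]) blast
  also have "\<dots> = card ({F \<in> \<F>. E \<subseteq> F \<and> F \<inter> D \<noteq> {}} \<union> {F \<in> \<F>. E \<subseteq> F \<and> F \<inter> D = {}})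
      + card {F \<in> \<F>. \<not> E \<subseteq> F}"
    using finite_family by (intro card_Un_disjoint) auto
  also have "card ({F \<in> \<F>. E \<subseteq> F \<and> F \<inter> D \<noteq> {}} \<union> {F \<in> \<F>. E \<subseteq> F \<and> F \<inter> D = {}})
      = card {F \<in> \<F>. E \<subseteq> F \<and> F \<inter> D \<noteq> {}} + card {F \<in> \<F>. E \<subseteq> F \<and> F \<inter> D = {}}"
    using finite_family by (intro card_Un_disjoint) auto
  finally show ?thesis .
qed

section \<open>Identification of the family when \<open>D\<close> is large\<close>

lemma family_eq_H1_on:
  assumes none: "{F \<in> \<F>. E \<subseteq> F \<and> F \<inter> D = {}} = {}" and "2 \<le> card D"
  shows "\<F> = H1_on n r k t E X"
proof (rule maximal_eq)
  show "\<F> \<subseteq> H1_on n r k t E X"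
  proof
    fix F assume F: "F \<in> \<F>"
    show "F \<in> H1_on n r k t E X"
    proof (cases "E \<subseteq> F")
      case True
      then obtain x where x: "x \<in> F" "x \<in> D" using none F by blast
      then have "x \<notin> E" using D_disjoint by blast
      have "card (insert x E) \<le> card (F \<inter> X)"
        using x True finiteE finiteD by (intro card_mono) auto
      then have "t + 1 \<le> card (F \<inter> X)" using \<open>x \<notin> E\<close> finiteE cardE by simp
      then show ?thesis using True mem(1)[OF F] by (simp add: H1_on_def)
    next
      case False
      then show ?thesis using card_missing_Int[OF F False] mem(1)[OF F] t
        by (simp add: H1_on_def cardX)
    qed
  qed
  show "H1_on n r k t E X \<subseteq> signed_sets n r k" by (auto simp: H1_on_def)
  show "t_intersecting t (H1_on n r k t E X)"
    using finiteE finiteD cardX assms(2) cardE by (intro t_intersecting_H1_on) auto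
qed

lemma no_avoiding_D:
  assumes "card D = r - t + 1"
  shows "{F \<in> \<F>. E \<subseteq> F \<and> F \<inter> D = {}} = {}"
proof -
  have "F0 - X = {}" using card_missing_Diff[OF F0] assms mem(3)[OF F0(1)] by simp
  then have "False" if "F \<in> \<F>" "E \<subseteq> F" "F \<inter> D = {}" for F
    using avoiding_D_meets[OF that F0] that by (simp only: Int_empty_right)
  then show ?thesis by (simp only: Collect_empty_eq) blast
qed

text \<open>Each member not containing \<open>E\<close> has exactly one point outside
  \<open>X\<close>. \<open>Y\<close> collects these points, and every member through
  \<open>E\<close> avoiding \<open>D\<close> must contain them all.\<close>

lemma family_eq_H2_on:
  assumes "G \<in> \<F>" "E \<subseteq> G" "G \<inter> D = {}" and cD: "card D = r - t"
  obtains Y where "X \<inter> Y = {}" "X \<union> Y \<in> signed_sets n (r + card Y) k" "2 \<le> card Y" "card Y \<le> r - t"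
    "\<F> = H2_on n r k t E X Y"
proof -
  have cX: "card X = r" using cardX cD tr by simp
  define Y where "Y = {y. \<exists>F\<in>\<F>. \<not> E \<subseteq> F \<and> y \<in> F - X}"
  have single: "\<exists>y. F - X = {y}" if "F \<in> \<F>" "\<not> E \<subseteq> F" for F
    using card_missing_Diff[OF that] cD card_1_singletonE[of "F - X"] by force
  have YH: "Y \<subseteq> H" if "H \<in> \<F>" "E \<subseteq> H" "H \<inter> D = {}" for H
  proof
    fix y assume "y \<in> Y"
    then obtain F where F: "F \<in> \<F>" "\<not> E \<subseteq> F" "y \<in> F - X" by (auto simp: Y_def)
    obtain z where z: "F - X = {z}" using single[OF F(1,2)] by (elim exE)
    have "y = z" using F(3) unfolding z by simp
    moreover have "H \<inter> {z} \<noteq> {}" using avoiding_D_meets[OF that F(1,2)] unfolding z .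
    ultimately show "y \<in> H" by blast
  qed
  have YG: "Y \<subseteq> G" using YH assms by blast
  have finY: "finite Y" using YG mem(3)[OF assms(1)] by (rule finite_subset)
  have disj: "X \<inter> Y = {}" by (auto simp: Y_def)
  have cXY: "card (X \<union> Y) = r + card Y"
    using cX disj finY finiteE finiteD by (simp add: card_Un_disjoint)
  have signed: "X \<union> Y \<in> signed_sets n (r + card Y) k"
  proof (rule signed_setsI[OF _ _ cXY])
    show "X \<union> Y \<subseteq> {1..n} \<times> {1..k}"
      using signed_setsD(1)[OF signedX] signed_setsD(1)[OF mem(1)[OF assms(1)]] YG by blast
    \<comment> \<open>A point of \<open>D\<close> and one of \<open>Y\<close> share a member lacking
      a point of \<open>E\<close>; a point of \<open>E \<union> Y\<close> and one of
      \<open>Y\<close> share \<open>G\<close>.\<close>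
    have *: "\<exists>S q. S \<in> signed_sets n q k \<and> x \<in> S \<and> y \<in> S" if xy: "x \<in> X \<union> Y" "y \<in> Y" for x y
    proof (cases "x \<in> D")
      case True
      obtain F where "F \<in> \<F>" "\<not> E \<subseteq> F" "y \<in> F" using xy(2) by (auto simp: Y_def)
      then show ?thesis using True missing(2)[of F] mem(1)[of F] by blast
    next
      case False
      then have "x \<in> G" "y \<in> G" using xy YG assms(2) by auto
      then show ?thesis using mem(1)[OF assms(1)] by blast
    qed
    show "inj_on fst (X \<union> Y)"
    proof (rule inj_onI)
      fix x y assume xy: "x \<in> X \<union> Y" "y \<in> X \<union> Y" "fst x = fst y"
      obtain S q where "S \<in> signed_sets n q k" "x \<in> S" "y \<in> S"
        using *[of x y] *[of y x] xy(1,2) signedX by blast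
      then show "x = y" using inj_onD[OF signed_setsD(2)] xy(3) by blast
    qed
  qed
  \<comment> \<open>That \<open>E\<close> and \<open>Y\<close> both fit into \<open>G\<close> is the
    source of the upper limit \<open>2 * r - t\<close> for \<open>c\<close> in
    \<open>H2\<close>.\<close>
  have "E \<union> Y \<subseteq> G" using YG assms(2) by blast
  then have "card (E \<union> Y) \<le> r" using mem(2,3)[OF assms(1)] card_mono by metis
  moreover have "card (E \<union> Y) = t + card Y"
    using disj finiteE finY cardE by (subst card_Un_disjoint) auto
  ultimately have leY: "card Y \<le> r - t" by simp
  have YF: "F \<inter> Y = F - X" if "F \<in> \<F>" "\<not> E \<subseteq> F" for F
    using that disj by (auto simp: Y_def)
  have "card Y \<noteq> 0"
    using single[OF F0] F0 finY by (auto simp: Y_def)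
  moreover have "card Y \<noteq> 1"
    \<comment> \<open>a single such point would give another cover of size \<open>t + 1\<close>\<close>
  proof
    assume "card Y = 1"
    then obtain y where y: "Y = {y}" by (rule card_1_singletonE)
    have yE: "y \<notin> E" "y \<notin> D" using y disj by auto
    have "insert y E \<subseteq> G" using y YG assms(2) by blast
    then have "insert y E \<in> signed_sets n (card (insert y E)) k"
      using signed_sets_subset mem(1)[OF assms(1)] by blast
    then have "insert y E \<in> signed_sets n (t + 1) k" using yE cardE finiteE by simp
    moreover have "t \<le> card (insert y E \<inter> F)" if F: "F \<in> \<F>" for F
    proof (cases "E \<subseteq> F")
      case True
      then have "card E \<le> card (insert y E \<inter> F)" using finiteE by (intro card_mono) auto
      then show ?thesis using cardE by simp
    next
      case False
      obtain z where "F \<inter> Y = {z}" using single[OF F False] unfolding YF[OF F False] by (elim exE)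
      then have "z \<in> F \<inter> Y" by simp
      then have "y \<in> F" by (auto simp: y)
      then have "insert y E \<inter> F = insert y (E \<inter> F)" by blast
      then have "card (insert y E \<inter> F) = card (insert y (E \<inter> F))" by (simp only:)
      also have "\<dots> = t" using missing(1)[OF F False] yE finiteE t by simp
      finally show ?thesis by simp
    qed
    ultimately have "insert y E \<in> covers" by (simp add: covers_def cover_def)
    then show False using yE by (simp add: D_def)
  qed
  ultimately have geY: "2 \<le> card Y" by simp
  have "\<F> = H2_on n r k t E X Y"
  proof (rule maximal_eq)
    show "\<F> \<subseteq> H2_on n r k t E X Y"
    proof
      fix F assume F: "F \<in> \<F>"
      consider "E \<subseteq> F" "F \<inter> D = {}" | x where "E \<subseteq> F" "x \<in> F" "x \<in> D" | "\<not> E \<subseteq> F" by blast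
      then show "F \<in> H2_on n r k t E X Y"
      proof cases
        case 1
        then have "F \<inter> X = E" "Y \<subseteq> F" using YH[OF F] by auto
        then show ?thesis using mem(1)[OF F] by (simp add: H2_on_def)
      next
        case (2 x)
        then have "x \<notin> E" using D_disjoint by blast
        have "card (insert x E) \<le> card (F \<inter> X)"
          using 2 finiteE finiteD by (intro card_mono) auto
        then have "t + 1 \<le> card (F \<inter> X)" using \<open>x \<notin> E\<close> finiteE cardE by simp
        then show ?thesis using 2(1) mem(1)[OF F] by (simp add: H2_on_def)
      next
        case 3
        have "card (F \<inter> X) = r - 1" using card_missing_Int[OF F 3] cD t tr by simp
        moreover obtain z where "F \<inter> Y = {z}" using single[OF F 3] unfolding YF[OF F 3] by (elim exE)
        then have "card (F \<inter> Y) = 1" by simp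
        ultimately show ?thesis using 3 mem(1)[OF F] by (simp add: H2_on_def)
      qed
    qed
    show "H2_on n r k t E X Y \<subseteq> signed_sets n r k" by (auto simp: H2_on_def)
    show "t_intersecting t (H2_on n r k t E X Y)"
      using finiteE finiteD cX cardE disj finY r_ge by (intro t_intersecting_H2_on) auto
  qed
  then show ?thesis using that disj signed geY leY by blast
qed

end

section \<open>Comparison with \<open>f n r k r t\<close>\<close>

context sunflower_covers
begin

lemma card_less_few_points:
  fixes B :: real
  assumes x: "real (N (t + 2)) = B * real (N (t + 1))" and pos: "real (N (t + 1)) > 0" and "B \<ge> 0"
    and b: "B * (real (r - t) + 3) * ((real t + 1) * (real t + 2)) \<le> 2"
      "B * (real (r - t) + 3) * (real (r - t) + 1) \<le> 2"
    and few: "card D < r - t"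
  shows "real (card \<F>) < (real (r - t) - real (r - t) * (real (r - t) - 1) / 2 * B) * real (N (t + 1))"
proof -
  define s where "s = r - t"
  have s2: "2 \<le> s" using r_ge by (simp add: s_def)
  have t1: "real t \<ge> 1" using t by simp
  note b' = b[folded s_def]
  have p1: "card D \<ge> 1" using D_nonempty finiteD by (simp add: Suc_le_eq card_gt_0_iff)
  have le: "card \<F> \<le> card D * N (t + 1) + (s + 1 - card D) * ((s + 1) * N (t + 2)) + c * N (t + 2)"
    if "card {F \<in> \<F>. \<not> E \<subseteq> F} \<le> c * N (t + 2)" for c
    using that card_split card_meeting_D card_avoiding_D by (simp add: s_def)
  have sub: "real (s + 1 - card D) = real s + 1 - real (card D)" using few by (simp add: s_def)
  have bound: "real (card \<F>)
      \<le> (real (card D) + ((real s + 1 - real (card D)) * (real s + 1) + real c) * B) * real (N (t + 1))"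
    if "card {F \<in> \<F>. \<not> E \<subseteq> F} \<le> c * N (t + 2)" for c
  proof -
    have "real (card \<F>) \<le> real (card D * N (t + 1) + (s + 1 - card D) * ((s + 1) * N (t + 2)) + c * N (t + 2))"
      using le[OF that] by (simp only: of_nat_le_iff)
    also have "\<dots> = (real (card D) + ((real s + 1 - real (card D)) * (real s + 1) + real c) * B) * real (N (t + 1))"
      by (simp only: of_nat_add of_nat_mult sub x of_nat_1) (simp add: algebra_simps)
    finally show ?thesis .
  qed
  \<comment> \<open>The witnesses are \<open>t * (s * (s + 1))\<close>, \<open>t * (s + 1)\<close>
    and \<open>t\<close>, according to the number of branchings.\<close>
  have "\<exists>c. card {F \<in> \<F>. \<not> E \<subseteq> F} \<le> c * N (t + 2) \<and>
      real (card D) + ((real s + 1 - real (card D)) * (real s + 1) + real c) * B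
        < real s - real s * (real s - 1) / 2 * B"
  proof -
    consider "card D = 1" | "card D = 2" | "3 \<le> card D" using p1 by linarith
    then show ?thesis
    proof cases
      case 1
      have "card {F \<in> \<F>. \<not> E \<subseteq> F} \<le> (t * (s * (s + 1))) * N (t + 2)"
        using card_missing_1[OF 1] by (simp only: s_def mult.assoc)
      moreover have "real (card D) + ((real s + 1 - real (card D)) * (real s + 1) + real (t * (s * (s + 1)))) * B
          = 1 + (real t + 1) * real s * (real s + 1) * B"
        by (simp add: 1 algebra_simps)
      moreover have "1 + (real t + 1) * real s * (real s + 1) * B < real s - real s * (real s - 1) / 2 * B"
        by (rule compare_one_point) (use s2 t1 assms(3) b' in simp_all)
      ultimately show ?thesis by (blast intro: ord_eq_less_trans)
    next
      case 2
      have "card {F \<in> \<F>. \<not> E \<subseteq> F} \<le> (t * (s + 1)) * N (t + 2)"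
        using card_missing_2[OF 2] by (simp only: s_def mult.assoc)
      moreover have "real (card D) + ((real s + 1 - real (card D)) * (real s + 1) + real (t * (s + 1))) * B
          = 2 + ((real s - 1) * (real s + 1) + real t * (real s + 1)) * B"
        by (simp add: 2 algebra_simps)
      moreover have "2 + ((real s - 1) * (real s + 1) + real t * (real s + 1)) * B
          < real s - real s * (real s - 1) / 2 * B"
        by (rule compare_two_points) (use few 2 t1 assms(3) b' in \<open>simp_all add: s_def\<close>)
      ultimately show ?thesis by (blast intro: ord_eq_less_trans)
    next
      case 3
      have "real (card D) \<le> real s - 1" using few by (simp add: s_def)
      then have "real (card D) + ((real s + 1 - real (card D)) * (real s + 1) + real t) * B
          < real s - real s * (real s - 1) / 2 * B"
        using s2 by (intro compare_many_points t1 assms(3) b') simp_all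
      then show ?thesis using card_missing_3[OF 3] by blast
    qed
  qed
  then obtain c where c: "card {F \<in> \<F>. \<not> E \<subseteq> F} \<le> c * N (t + 2)"
    "real (card D) + ((real s + 1 - real (card D)) * (real s + 1) + real c) * B
        < real s - real s * (real s - 1) / 2 * B" by blast
  from mult_strict_right_mono[OF c(2) pos] bound[OF c(1)] show ?thesis
    unfolding s_def[symmetric] by (rule le_less_trans[rotated])
qed

end

lemma real_choose_two: "real (m choose 2) = real m * (real m - 1) / 2"
  by (induction m) (simp_all add: numeral_2_eq_2 field_simps)

lemma binom_eq: "a \<le> b \<Longrightarrow> binom (int b - int a) (int j) = real ((b - a) choose j)"
  unfolding binom_def binomial_gbinomial by simp

text \<open>For \<open>r = t + 1\<close> the last term vanishes on both sides, by the conventions of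
  \<open>binom\<close> and of \<open>star_size\<close>.\<close>

lemma f_eq:
  assumes "t + 1 \<le> r" "r \<le> n" "t + 2 \<le> n"
  shows "f n r k r t = real (r - t) * real (star_size n r k (t + 1))
    - real (r - t) * (real (r - t) - 1) / 2 * real (star_size n r k (t + 2))"
proof -
  have e1: "real r - real t = real (r - t)" using assms by simp
  have e2: "binom (int r - int t) 2 = real (r - t) * (real (r - t) - 1) / 2"
    using binom_eq[of t r 2] assms by (simp add: real_choose_two)
  have e3: "binom (int n - int t - 1) (int r - int t - 1) * real k powi (int r - int t - 1)
      = real (star_size n r k (t + 1))"
  proof -
    have "int n - int t - 1 = int n - int (t + 1)" "int r - int t - 1 = int (r - (t + 1))"
      using assms by simp_all
    then show ?thesis
      using assms binom_eq[of "t + 1" n "r - (t + 1)"] by (simp only: power_int_of_nat) (simp add: star_size_def)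
  qed
  have e4: "binom (int n - int t - 2) (int r - int t - 2) * real k powi (int r - int t - 2)
      = real (star_size n r k (t + 2))"
  proof (cases "t + 2 \<le> r")
    case True
    then have "int n - int t - 2 = int n - int (t + 2)" "int r - int t - 2 = int (r - (t + 2))"
      using assms by simp_all
    then show ?thesis
      using assms True binom_eq[of "t + 2" n "r - (t + 2)"] by (simp only: power_int_of_nat) (simp add: star_size_def)
  next
    case False
    then show ?thesis by (simp add: binom_def star_size_def)
  qed
  show ?thesis unfolding f_def by (simp only: mult.assoc e3 e4 e1 e2)
qed

text \<open>This explains \<open>f\<close>: it is the Bonferroni lower bound for a union of
  \<open>r - t\<close> stars over \<open>(t + 1)\<close>-sets.\<close>

lemma card_ge_f:
  assumes "t + 1 \<le> r" "r \<le> n" "t + 2 \<le> n" "\<G> \<subseteq> signed_sets n r k"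
    and T: "\<T> \<subseteq> signed_sets n (t + 1) k" "card \<T> = r - t"
    and star: "\<And>T F. T \<in> \<T> \<Longrightarrow> F \<in> signed_sets n r k \<Longrightarrow> T \<subseteq> F \<Longrightarrow> F \<in> \<G>"
  shows "f n r k r t \<le> real (card \<G>)"
proof -
  have "finite \<T>" using T(1) finite_signed_sets by (rule finite_subset)
  from card_UN_stars_ge[OF this T(1), of r]
  have "f n r k r t \<le> real (card (\<Union>T\<in>\<T>. {F \<in> signed_sets n r k. T \<subseteq> F}))"
    by (simp only: T(2) real_choose_two f_eq[OF assms(1-3)])
  also have "\<dots> \<le> real (card \<G>)"
    using star assms(4) by (intro of_nat_mono card_mono finite_subset[OF assms(4) finite_signed_sets]) auto
  finally show ?thesis .
qed

section \<open>Sizes of the extremal families and the final estimates\<close>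

lemma card_M: "card (M d) = d"
  by (simp add: M_def card_cartesian_product)

lemma M_signed: "d \<le> n \<Longrightarrow> 1 \<le> k \<Longrightarrow> M d \<in> signed_sets n d k"
  by (rule signed_setsI) (auto simp: M_def inj_on_def card_cartesian_product)

lemma finite_M: "finite (M d)"
  by (simp add: M_def)

lemma M_mono: "d \<le> d' \<Longrightarrow> M d \<subseteq> M d'"
  by (auto simp: M_def)

text \<open>The \<open>r - t\<close> stars are those over \<open>M t\<close> extended by one point
  of \<open>M r - M t\<close>.\<close>

lemma card_ge_f_M:
  assumes "t + 1 \<le> r" "r \<le> n" "t + 2 \<le> n" "1 \<le> k" "\<G> \<subseteq> signed_sets n r k"
    and star: "\<And>F. F \<in> signed_sets n r k \<Longrightarrow> M t \<subseteq> F \<Longrightarrow> t + 1 \<le> card (F \<inter> M r) \<Longrightarrow> F \<in> \<G>"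
  shows "f n r k r t \<le> real (card \<G>)"
proof (rule card_ge_f[OF assms(1-3,5)])
  let ?T = "\<lambda>j. insert (j, 1) (M t)"
  have sub: "?T j \<subseteq> M r" if "j \<in> {t + 1..r}" for j using that assms(1) by (auto simp: M_def)
  have card: "card (?T j) = t + 1" if "j \<in> {t + 1..r}" for j
    using that finite_M card_M[of t] by (auto simp: M_def)
  show "?T ` {t + 1..r} \<subseteq> signed_sets n (t + 1) k"
    using sub card signed_sets_subset[OF M_signed[OF assms(2,4)]] by (metis (no_types, lifting) image_subsetI)
  have "inj_on ?T {t + 1..r}"
  proof (rule inj_onI)
    fix i j assume ij: "i \<in> {t + 1..r}" "j \<in> {t + 1..r}" "?T i = ?T j"
    then have "(i, 1) \<in> ?T j" by blast
    then show "i = j" using ij(1) by (auto simp: M_def)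
  qed
  then show "card (?T ` {t + 1..r}) = r - t" by (simp add: card_image)
  fix T F assume TF: "T \<in> ?T ` {t + 1..r}" "F \<in> signed_sets n r k" "T \<subseteq> F"
  then obtain j where j: "j \<in> {t + 1..r}" "T = ?T j" by blast
  have "card T \<le> card (F \<inter> M r)"
    using TF(3) sub[OF j(1)] j(2) finite_M by (intro card_mono) auto
  then show "F \<in> \<G>" using TF j card[OF j(1)] by (intro star) auto
qed

lemma card_H1_ge:
  assumes "t + 1 \<le> r" "r \<le> n" "t + 2 \<le> n" "1 \<le> k" "r \<le> m"
  shows "f n r k r t \<le> real (card (H1 n r k m t))"
proof (rule card_ge_f_M[OF assms(1-4)])
  fix F assume F: "F \<in> signed_sets n r k" "M t \<subseteq> F" "t + 1 \<le> card (F \<inter> M r)"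
  have "card (F \<inter> M r) \<le> card (F \<inter> M m)"
    using M_mono[OF assms(5)] finite_M by (intro card_mono) auto
  then show "F \<in> H1 n r k m t" using F by (simp add: H1_def)
qed (unfold H1_def, rule Collect_restrict)

lemma card_H2_ge:
  assumes "t + 1 \<le> r" "r \<le> n" "t + 2 \<le> n" "1 \<le> k"
  shows "f n r k r t \<le> real (card (H2 n r k c t))"
proof (rule card_ge_f_M[OF assms])
  fix F assume "F \<in> signed_sets n r k" "M t \<subseteq> F" "t + 1 \<le> card (F \<inter> M r)"
  then show "F \<in> H2 n r k c t" unfolding H2_def by (intro CollectI conjI disjI1)
qed (unfold H2_def, rule Collect_restrict)

text \<open>For \<open>card X = t + 2\<close> both clauses ask for \<open>t + 1\<close> points of
  \<open>X\<close>, because a set lacking a point of \<open>E\<close> cannot contain all of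
  \<open>X\<close>. So \<open>E\<close> may be any \<open>t\<close>-subset of
  \<open>X\<close>.\<close>

lemma H1_on_near_full:
  assumes "finite X" "card X = t + 2" "E \<subseteq> X" "card E = t"
  shows "H1_on n r k t E X = {F \<in> signed_sets n r k. t + 1 \<le> card (F \<inter> X)}"
proof -
  have "card (F \<inter> X) \<le> t + 1" if "\<not> E \<subseteq> F" for F
  proof -
    have "\<not> X \<subseteq> F" using that assms(3) by (meson order_trans)
    from card_not_subset_Int[OF assms(1) this] show ?thesis using assms(2) by (simp add: Int_commute)
  qed
  then have "(E \<subseteq> F \<and> t + 1 \<le> card (F \<inter> X)) \<or> (\<not> E \<subseteq> F \<and> card (F \<inter> X) = card X - 1)
      \<longleftrightarrow> t + 1 \<le> card (F \<inter> X)" for F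
    using assms(2) by (cases "E \<subseteq> F") (auto intro: order_antisym)
  then show ?thesis unfolding H1_on_def by (simp only:)
qed

lemma H1_near_full:
  "H1 n r k (t + 2) t = {F \<in> signed_sets n r k. t + 1 \<le> card (F \<inter> M (t + 2))}"
  using H1_on_near_full[of "M (t + 2)" t "M t" n r k] finite_M card_M M_mono[of t "t + 2"]
  by (simp add: H1_def H1_on_def)

lemma card_near_full_ge:
  assumes X: "X \<in> signed_sets n (t + 2) k"
  shows "(real t + 2) * real (star_size n r k (t + 1))
      - (real t + 2) * (real t + 1) / 2 * real (star_size n r k (t + 2))
    \<le> real (card {F \<in> signed_sets n r k. t + 1 \<le> card (F \<inter> X)})"
proof -
  note X' = signed_setsD[OF X]
  let ?\<T> = "{T. T \<subseteq> X \<and> card T = t + 1}"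
  have fin: "finite ?\<T>" using X'(4) by simp
  have card: "card ?\<T> = t + 2" using n_subsets[OF X'(4), of "t + 1"] X'(3) by simp
  have signed: "?\<T> \<subseteq> signed_sets n (t + 1) k"
  proof clarify
    fix T assume "T \<subseteq> X" "card T = t + 1"
    then show "T \<in> signed_sets n (t + 1) k" using signed_sets_subset[OF X, of T] by simp
  qed
  have "(\<Union>T\<in>?\<T>. {F \<in> signed_sets n r k. T \<subseteq> F}) \<subseteq> {F \<in> signed_sets n r k. t + 1 \<le> card (F \<inter> X)}"
  proof clarify
    fix F T assume *: "F \<in> signed_sets n r k" "T \<subseteq> F" "T \<subseteq> X" "card T = t + 1"
    then show "t + 1 \<le> card (F \<inter> X)" using card_mono[of "F \<inter> X" T] X'(4) by simp
  qed
  then have "real (card (\<Union>T\<in>?\<T>. {F \<in> signed_sets n r k. T \<subseteq> F}))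
      \<le> real (card {F \<in> signed_sets n r k. t + 1 \<le> card (F \<inter> X)})"
    using finite_signed_sets by (intro of_nat_mono card_mono) auto
  with card_UN_stars_ge[OF fin signed, of r] show ?thesis
    unfolding card real_choose_two by (simp add: algebra_simps)
qed

text \<open>The witness is \<open>(s - 1) / ((n - t - 1) * k)\<close>, the bound on consecutive star
  sizes; \<open>k \<ge> g n r t\<close> says that \<open>b * (s + 3)\<close> times either term of
  the maximum is at most 1.\<close>

lemma ratio_le:
  assumes "t + 1 \<le> r" "r \<le> n" "t + 2 \<le> n" "1 \<le> k" and le: "g n r t \<le> real k"
  obtains b :: real where "b \<ge> 0"
    "b * (real (r - t) + 3) * ((real t + 1) * (real t + 2)) \<le> 2"
    "b * (real (r - t) + 3) * (real (r - t) + 1) \<le> 2"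
    "\<forall>q\<ge>t + 1. real (star_size n r k (Suc q)) \<le> b * real (star_size n r k q)"
proof -
  define s where "s = real (r - t)"
  have s: "s = real r - real t" "s \<ge> 1" using assms by (simp_all add: s_def)
  define d where "d = (real n - real t - 1) * real k"
  have nt: "real n - real t - 1 > 0" using assms(3) by simp
  have d: "d > 0" using nt assms(4) by (simp add: d_def)
  define b where "b = (s - 1) / d"
  have b0: "b \<ge> 0" using s d by (simp add: b_def)
  have g_s: "g n r t = (s + 3) * (s - 1) / (real n - real t - 1) * max (binom (int t + 2) 2) ((s + 1) / 2)"
    unfolding g_def s(1) by (rule refl)
  have m: "b * (s + 3) * m \<le> 1" if "m \<le> max (binom (int t + 2) 2) ((s + 1) / 2)" for m
  proof -
    have "(s + 3) * (s - 1) / (real n - real t - 1) * m \<le> g n r t"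
      unfolding g_s using that by (rule mult_left_mono) (use s(2) nt in simp)
    also note le
    finally have "(s + 3) * (s - 1) * m \<le> real k * (real n - real t - 1)"
      using nt by (simp add: field_simps)
    then show ?thesis using d by (simp add: b_def d_def field_simps)
  qed
  have "binom (int t + 2) 2 = (real t + 1) * (real t + 2) / 2"
    using binom_eq[of 0 "t + 2" 2] by (simp add: real_choose_two add.commute mult.commute)
  then have "b * (s + 3) * ((real t + 1) * (real t + 2) / 2) \<le> 1"
    using m[of "binom (int t + 2) 2"] by (simp only: max.cobounded1)
  then have 1: "b * (s + 3) * ((real t + 1) * (real t + 2)) \<le> 2"
    by (simp only: times_divide_eq_right)
  have 2: "b * (s + 3) * (s + 1) \<le> 2"
    using m[of "(s + 1) / 2"] by simp
  have 3: "real (star_size n r k (Suc q)) \<le> b * real (star_size n r k q)" if "t + 1 \<le> q" for q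
    using star_size_Suc[OF that assms(3,2,4,1)] d
    unfolding b_def d_def[symmetric] s(1) by (simp add: field_simps)
  show ?thesis using that[OF b0] 1 2 3 unfolding s_def by blast
qed

lemma near_full_iso_H1:
  assumes X: "X \<in> signed_sets n (t + 2) k" and "1 \<le> k"
  shows "family_iso n k {F \<in> signed_sets n r k. t + 1 \<le> card (F \<inter> X)} (H1 n r k (t + 2) t)"
proof -
  note X' = signed_setsD[OF X]
  obtain E where E: "E \<subseteq> X" "card E = t"
    using obtain_subset_with_card_n[of t X] X'(3) by auto
  show ?thesis using H1_on_iso[OF X E assms(2), of r] H1_on_near_full[OF X'(4,3) E, of n r k] by simp
qed

lemma (in sunflower_covers) many_points_iso:
  assumes "r - t \<le> card D"
  shows "(\<exists>m\<in>{r, min (r + 1) n}. family_iso n k \<F> (H1 n r k m t)) \<or>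
    (r + 2 \<le> n \<and> (\<exists>c\<in>{r + 2..min (2 * r - t) n}. family_iso n k \<F> (H2 n r k c t)))"
proof -
  have k1: "1 \<le> k" using k by simp
  have D2: "2 \<le> card D" using assms r_ge by simp
  have sub: "E \<subseteq> X" by blast
  have le_n: "q \<le> n" if "S \<in> signed_sets n q k" for S q
  proof -
    note S = signed_setsD[OF that]
    have "card (fst ` S) \<le> card {1..n}" using S(1) by (intro card_mono) auto
    then show ?thesis using S(2,3) by (simp add: card_image)
  qed
  consider "card D = r - t + 1" | "card D = r - t" "{F \<in> \<F>. E \<subseteq> F \<and> F \<inter> D = {}} = {}"
    | G where "card D = r - t" "G \<in> \<F>" "E \<subseteq> G" "G \<inter> D = {}"
    using assms cardD_le by (cases "card D = r - t + 1") (fastforce)+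
  then show ?thesis
  proof cases
    case 1
    have c: "t + card D = r + 1" using 1 tr by simp
    \<comment> \<open>\<open>X\<close> is a signed set with \<open>r + 1\<close> points, so
      \<open>r < n\<close> here.\<close>
    have "min (r + 1) n = r + 1" using le_n[OF signedX] c by simp
    moreover have "family_iso n k \<F> (H1 n r k (r + 1) t)"
      using H1_on_iso[OF signedX sub cardE k1, of r] family_eq_H1_on[OF no_avoiding_D[OF 1] D2] c by simp
    ultimately show ?thesis by simp
  next
    case 2
    have "t + card D = r" using 2 tr by simp
    then have "family_iso n k \<F> (H1 n r k r t)"
      using H1_on_iso[OF signedX sub cardE k1, of r] family_eq_H1_on[OF 2(2) D2] by simp
    then show ?thesis by simp
  next
    case (3 G)
    obtain Y where Y: "X \<inter> Y = {}" "X \<union> Y \<in> signed_sets n (r + card Y) k" "2 \<le> card Y" "card Y \<le> r - t"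
      "\<F> = H2_on n r k t E X Y"
      by (rule family_eq_H2_on[OF 3(2-4,1)])
    have "card X = r" using cardX 3(1) tr by simp
    then have "family_iso n k \<F> (H2 n r k (r + card Y) t)"
      using H2_on_iso[OF Y(2,1) _ sub cardE k1] Y(5) by simp
    moreover have "r + card Y \<in> {r + 2..min (2 * r - t) n}" using le_n[OF Y(2)] Y(3,4) tr by simp
    moreover have "r + 2 \<le> n" using le_n[OF Y(2)] Y(3) by simp
    ultimately show ?thesis by blast
  qed
qed

theorem theorem1p1:
  fixes n r k t :: nat and \<F> :: "(nat \<times> nat) set set"
  assumes "n \<ge> 1" and "r \<ge> 1" and "k \<ge> 1" and "t \<ge> 1"
    and "n \<ge> t + 2" and "n \<ge> r" and "r \<ge> t + 1"
    and "real k \<ge> max 2 (g n r t)"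
    and "maximal_t_intersecting n r k t \<F>"
    and "\<not> trivial_family n k t \<F>"
  shows "real (card \<F>) \<ge> f n r k r t \<longleftrightarrow>
     (r \<ge> t + 2 \<and> (\<exists>m \<in> {r, min (r + 1) n}. family_iso n k \<F> (H1 n r k m t))) \<or>
     (n \<ge> r + 2 \<and> r + 2 \<ge> t + 4 \<and>
        (\<exists>c \<in> {r + 2..min (2 * r - t) n}. family_iso n k \<F> (H2 n r k c t))) \<or>
     (r \<le> 2 * t + 2 \<and> r \<noteq> t + 2 \<and> family_iso n k \<F> (H1 n r k (t + 2) t))"
proof -
  have k2: "2 \<le> k" and g: "g n r t \<le> real k" using assms(8) by simp_all
  have k1: "1 \<le> k" using k2 by simp
  note base = assms(7,6,5)
  interpret maximal_nontrivial_family n r k t \<F>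
    using assms k2 by unfold_locales auto
  obtain b where b: "b \<ge> 0" "b * (real (r - t) + 3) * ((real t + 1) * (real t + 2)) \<le> 2"
    "b * (real (r - t) + 3) * (real (r - t) + 1) \<le> 2"
    "\<forall>q\<ge>t + 1. real (star_size n r k (Suc q)) \<le> b * real (star_size n r k q)"
    by (rule ratio_le[OF base k1 g])
  define s where "s = real (r - t)"
  \<comment> \<open>Two ratios are kept: \<open>f\<close> contains the star over a
    \<open>(t + 2)\<close>-set with a negative sign, so its ratio \<open>B\<close> must be exact,
    while \<open>b\<close> bounds all later ratios needed in the case without covers.\<close>
  define B where "B = real (N (t + 2)) / real (N (t + 1))"
  have pos: "real (N (t + 1)) > 0" using star_size_pos[OF k1 assms(7,6)] by simp
  have xB: "real (N (t + 2)) = B * real (N (t + 1))" using pos by (simp add: B_def)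
  have B0: "B \<ge> 0" by (simp add: B_def)
  have "B \<le> b" using b(4)[rule_format, of "t + 1"] pos by (simp add: B_def divide_le_eq)
  then have mono: "B * (s + 3) * c \<le> b * (s + 3) * c" if "c \<ge> 0" for c
    using that by (intro mult_right_mono) (simp_all add: s_def)
  have B1: "B * (s + 3) * ((real t + 1) * (real t + 2)) \<le> 2"
    by (rule order_trans[OF mono b(2)[folded s_def]]) simp
  have B2: "B * (s + 3) * (s + 1) \<le> 2"
    by (rule order_trans[OF mono b(3)[folded s_def]]) (simp add: s_def)
  have t1: "1 \<le> real t" using assms(4) by simp
  have f: "f n r k r t = (s - s * (s - 1) / 2 * B) * real (N (t + 1))"
    unfolding f_eq[OF base] xB s_def by (simp only: left_diff_distrib mult.assoc)
  have few_covers: "real (card \<F>) < f n r k r t" if "covers = {}"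
  proof -
    \<comment> \<open>For \<open>r = t + 1\<close> a member would be a cover of size
      \<open>t + 1\<close>.\<close>
    have "r \<noteq> t + 1"
    proof
      assume r: "r = t + 1"
      obtain F where F: "F \<in> \<F>" using nonempty by blast
      then have "F \<in> covers" using mem[OF F] inter[OF F] r by (simp add: covers_def cover_def)
      then show False using that by simp
    qed
    then have s2: "2 \<le> s" using assms(7) by (simp add: s_def)
    have ratio: "(r - t + 1) * ((t + 1) * (t + 2)) * N (Suc q) \<le> 2 * N q" if "t + 1 \<le> q" for q
    proof -
      have "(s + 1) * ((real t + 1) * (real t + 2)) * real (N (Suc q))
          \<le> (s + 1) * ((real t + 1) * (real t + 2)) * (b * real (N q))"
        using b(4) that s2 by (intro mult_left_mono) auto
      also have "\<dots> \<le> (s + 3) * ((real t + 1) * (real t + 2)) * (b * real (N q))"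
        using b(1) s2 by (intro mult_right_mono) auto
      also have "\<dots> = (b * (s + 3) * ((real t + 1) * (real t + 2))) * real (N q)" by (simp only: mult_ac)
      also have "\<dots> \<le> 2 * real (N q)" using b(2) unfolding s_def by (intro mult_right_mono) auto
      finally have "real ((r - t + 1) * ((t + 1) * (t + 2)) * N (Suc q)) \<le> real (2 * N q)"
        unfolding s_def by (simp only: of_nat_mult of_nat_add of_nat_1 of_nat_numeral)
      then show ?thesis by (simp only: of_nat_le_iff)
    qed
    have "(t + 2) choose t = (t + 2) choose 2" using binomial_symmetric[of t "t + 2"] by simp
    then have "card \<F> \<le> ((t + 2) choose 2) * ((r - t + 1) ^ 2 * N (t + 2))"
      using card_le_no_cover[OF that ratio] by simp
    then have "real (card \<F>) \<le> real (((t + 2) choose 2) * ((r - t + 1) ^ 2 * N (t + 2)))"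
      by (simp only: of_nat_le_iff)
    also have "\<dots> = ((real t + 2) * (real t + 1) / 2 * (s + 1)^2 * B) * real (N (t + 1))"
      by (simp only: of_nat_mult of_nat_power real_choose_two xB s_def of_nat_add) simp
    also have "\<dots> < (s - s * (s - 1) / 2 * B) * real (N (t + 1))"
      using compare_no_small_cover[OF s2 t1 B0 B1 B2] pos by (intro mult_strict_right_mono)
    finally show ?thesis using f by simp
  qed
  show ?thesis
  proof
    assume large: "f n r k r t \<le> real (card \<F>)"
    then have "covers \<noteq> {}" using few_covers by fastforce
    then show "(r \<ge> t + 2 \<and> (\<exists>m \<in> {r, min (r + 1) n}. family_iso n k \<F> (H1 n r k m t))) \<or>
     (n \<ge> r + 2 \<and> r + 2 \<ge> t + 4 \<and>
        (\<exists>c \<in> {r + 2..min (2 * r - t) n}. family_iso n k \<F> (H2 n r k c t))) \<or>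
     (r \<le> 2 * t + 2 \<and> r \<noteq> t + 2 \<and> family_iso n k \<F> (H1 n r k (t + 2) t))"
      (is "?i \<or> ?ii \<or> ?iii")
    proof (rule common_subset_or_triangle)
      fix E assume E: "card E = t" "\<forall>T\<in>covers. E \<subseteq> T"
      interpret sunflower_covers n r k t \<F> E
        by unfold_locales (use \<open>covers \<noteq> {}\<close> E in auto)
      have "r - t \<le> card D"
      proof (rule ccontr)
        assume "\<not> r - t \<le> card D"
        then have "card D < r - t" by simp
        from card_less_few_points[OF xB pos B0 _ _ this] have "real (card \<F>) < f n r k r t"
          using B1 B2 unfolding f s_def by simp
        then show False using large by simp
      qed
      from many_points_iso[OF this] show ?thesis using r_ge by auto
    next
      fix A1 A2 A3 assume A: "A1 \<in> covers" "A2 \<in> covers" "A3 \<in> covers" "A1 \<noteq> A2" "\<not> A1 \<inter> A2 \<subseteq> A3"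
      obtain Z where Z: "Z \<in> signed_sets n (t + 2) k"
        "\<F> = {F \<in> signed_sets n r k. t + 1 \<le> card (F \<inter> Z)}"
        by (rule triangle_structure[OF A])
      have iso: "family_iso n k \<F> (H1 n r k (t + 2) t)"
        using near_full_iso_H1[OF Z(1) k1, of r] Z(2) by simp
      have "r \<le> 2 * t + 2"
      proof (rule ccontr)
        assume "\<not> r \<le> 2 * t + 2"
        then have s3: "s \<ge> real t + 3" by (simp add: s_def)
        have "card \<F> \<le> (t + 2) * N (t + 1)"
          using card_near_full_le[OF signed_setsD(4,3)[OF Z(1)], of n r k] Z(2) by simp
        then have "real (card \<F>) \<le> real ((t + 2) * N (t + 1))" by (simp only: of_nat_le_iff)
        also have "\<dots> = (real t + 2) * real (N (t + 1))"
          by (simp only: of_nat_mult of_nat_add of_nat_numeral)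
        also have "\<dots> < (s - s * (s - 1) / 2 * B) * real (N (t + 1))"
          using compare_triangle_large[OF s3 t1 B0 B2] pos by (intro mult_strict_right_mono)
        finally show False using large f by simp
      qed
      \<comment> \<open>For \<open>r = t + 2\<close> the family \<open>H1 n r k (t + 2) t\<close> is
        the instance \<open>m = r\<close> of the first alternative.\<close>
      then show ?thesis using iso by (cases "r = t + 2") auto
    qed
  next
    assume "(r \<ge> t + 2 \<and> (\<exists>m \<in> {r, min (r + 1) n}. family_iso n k \<F> (H1 n r k m t))) \<or>
     (n \<ge> r + 2 \<and> r + 2 \<ge> t + 4 \<and>
        (\<exists>c \<in> {r + 2..min (2 * r - t) n}. family_iso n k \<F> (H2 n r k c t))) \<or>
     (r \<le> 2 * t + 2 \<and> r \<noteq> t + 2 \<and> family_iso n k \<F> (H1 n r k (t + 2) t))"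
    then consider m where "r \<le> m" "family_iso n k \<F> (H1 n r k m t)"
      | c where "family_iso n k \<F> (H2 n r k c t)"
      | "r \<le> 2 * t + 2" "family_iso n k \<F> (H1 n r k (t + 2) t)"
      using assms(6) by fastforce
    then show "f n r k r t \<le> real (card \<F>)"
    proof cases
      case (1 m)
      then show ?thesis
        using card_H1_ge[OF base k1 1(1)] family_iso_card[OF 1(2) subset_signed] by simp
    next
      case (2 c)
      then show ?thesis
        using card_H2_ge[OF base k1, of c] family_iso_card[OF 2 subset_signed] by simp
    next
      case 3
      have "r - t \<le> t + 1 \<or> r - t = t + 2" using 3(1) by linarith
      then have "s \<le> real t + 1 \<or> s = real t + 2" unfolding s_def by linarith
      moreover have "s \<ge> 1" using assms(7) by (simp add: s_def)
      ultimately have "s - s * (s - 1) / 2 * B \<le> (real t + 2) - (real t + 2) * (real t + 1) / 2 * B"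
        using t1 B0 B1 by (intro compare_triangle_small)
      from mult_right_mono[OF this, of "real (N (t + 1))"]
      have "f n r k r t \<le> (real t + 2) * real (N (t + 1)) - (real t + 2) * (real t + 1) / 2 * real (N (t + 2))"
        unfolding f xB by (simp only: left_diff_distrib mult.assoc)
      also have "\<dots> \<le> real (card (H1 n r k (t + 2) t))"
        unfolding H1_near_full by (rule card_near_full_ge[OF M_signed[OF assms(5) k1]])
      finally show ?thesis using family_iso_card[OF 3(2) subset_signed] by simp
    qed
  qed
qed

end
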